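(* For all $t\in\mathcal{T}'$ and all $u,v\in\mathcal{T}$, $$t\vartriangleright(u\rightarrow v)=(t\vartriangleright u)\rightarrow v+u\rightarrow(t\vartriangleright v).$$
   Context: Let $K$ be a field. Trees are isomorphism classes of finite non-planar rooted trees with at least one vertex; $\bullet$ denotes the tree with a single vertex and no edge. $\mathcal{T}$ is the $K$-vector space with basis all rooted trees (including $\bullet$), and $\mathcal{T}'\subset\mathcal{T}$ is the subspace spanned by the trees having at least one edge. Grafting law. An elementary cut $c$ of a tree $x$ is the choice of a single edge of $x$; removing that edge splits $x$ into two rooted trees: the trunk $R^c(x)$, which contains the root of $x$, and the branch $P^c(x)$, the other component, rooted at its vertex closest to the root of $x$. For trees $t,t',x$ let $N(t,t',x)$ be the number of elementary cuts $c$ of $x$ such that $P^c(x)=t$ and $R^c(x)=t'$. The bilinear map $\rightarrow:\mathcal{T}\times\mathcal{T}\to\mathcal{T}$ is defined on trees by $t\rightarrow t'=\sum_{x\text{ tree}}N(t,t',x)\,x$ (a finite sum). Insertion law. A (nontrivial) subtree $s$ of a tree $x$ is a connected subgraph with at least one edge, rooted at its vertex closest to the root of $x$; the contracted tree $x/s$ is the rooted tree obtained from $x$ by contracting $s$ to a single vertex. For a tree $t$ with at least one edge and trees $t',x$, let $\mathcal{N}(t,t',x)$ be the number of subtrees $s$ of $x$ isomorphic to $t$ such that $x/s$ is isomorphic to $t'$. The bilinear map $\vartriangleright:\mathcal{T}'\times\mathcal{T}\to\mathcal{T}$ is defined on trees by $t\vartriangleright t'=\sum_{x\text{ tree}}\mathcal{N}(t,t',x)\,x$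 (a finite sum); in particular $t\vartriangleright\bullet=t$. *)

theory Defs
  imports "Graph_Theory.Graph_Theory" "HOL-Library.Poly_Mapping"
begin

section \<open>Rooted trees as graphs\<close>

record ('a, 'b) rooted_digraph =
  graph_of :: "('a, 'b) pre_digraph"
  root_of :: 'a

abbreviation rverts :: "('a, 'b) rooted_digraph \<Rightarrow> 'a set" where
  "rverts X \<equiv> verts (graph_of X)"

abbreviation rarcs :: "('a, 'b) rooted_digraph \<Rightarrow> 'b set" where
  "rarcs X \<equiv> arcs (graph_of X)"

text \<open>
  The edges of a rooted tree are given their canonical orientation, away from the root, so that
  edges are arcs.  Uniqueness of the walk rules out cycles (also undirected ones), loops and
  multiple edges.  The predicate \<^const>\<open>Digraph_Component.tree\<close> only excludes directed cycles
  and is therefore not suitable here.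
\<close>

definition rooted_tree :: "('a, 'b) rooted_digraph \<Rightarrow> bool" where
  "rooted_tree X \<longleftrightarrow> fin_digraph (graph_of X) \<and> root_of X \<in> rverts X \<and>
     (\<forall>v \<in> rverts X. \<exists>!p. pre_digraph.awalk (graph_of X) (root_of X) p v)"

definition rooted_iso :: "('a, 'b) rooted_digraph \<Rightarrow> ('c, 'd) rooted_digraph \<Rightarrow> bool" where
  "rooted_iso X Y \<longleftrightarrow>
     (\<exists>f. pre_digraph.digraph_isomorphism (graph_of X) f \<and>
          graph_of Y = app_iso f (graph_of X) \<and> root_of Y = iso_verts f (root_of X))"

definition depth :: "('a, 'b) rooted_digraph \<Rightarrow> 'a \<Rightarrow> nat" where
  "depth X v = (LEAST n. \<exists>p. pre_digraph.awalk (graph_of X) (root_of X) p v \<and> length p = n)"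

definition closest :: "('a, 'b) rooted_digraph \<Rightarrow> 'a set \<Rightarrow> 'a" where
  "closest X W = (ARG_MIN (depth X) w. w \<in> W)"


subsection \<open>Elementary cuts\<close>

text \<open>Connectedness ignores the orientation, hence \<^const>\<open>mk_symmetric\<close>.\<close>

definition component_verts :: "('a, 'b) pre_digraph \<Rightarrow> 'a \<Rightarrow> 'a set" where
  "component_verts G v = {w. v \<rightarrow>\<^sup>*\<^bsub>with_proj (mk_symmetric G)\<^esub> w}"

definition trunk :: "('a, 'b) rooted_digraph \<Rightarrow> 'b \<Rightarrow> ('a, 'b) rooted_digraph" where
  "trunk X c =
     (let G = pre_digraph.del_arc (graph_of X) c
      in \<lparr> graph_of = G \<restriction> component_verts G (root_of X), root_of = root_of X \<rparr>)"

definition branch :: "('a, 'b) rooted_digraph \<Rightarrow> 'b \<Rightarrow> ('a, 'b) rooted_digraph" where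
  "branch X c =
     (let G = pre_digraph.del_arc (graph_of X) c;
          W = verts G - component_verts G (root_of X)
      in \<lparr> graph_of = G \<restriction> W, root_of = closest X W \<rparr>)"


subsection \<open>Subtrees and contraction\<close>

definition subtrees :: "('a, 'b) rooted_digraph \<Rightarrow> ('a, 'b) pre_digraph set" where
  "subtrees X = {S. subgraph S (graph_of X) \<and> connected S \<and> arcs S \<noteq> {}}"

definition root_subtree ::
    "('a, 'b) rooted_digraph \<Rightarrow> ('a, 'b) pre_digraph \<Rightarrow> ('a, 'b) rooted_digraph" where
  "root_subtree X S = \<lparr> graph_of = S, root_of = closest X (verts S) \<rparr>"

text \<open>The vertex to which \<open>S\<close> is contracted is named after the root of \<open>S\<close>.\<close>

definition contract_vert ::
    "('a, 'b) rooted_digraph \<Rightarrow> ('a, 'b) pre_digraph \<Rightarrow> 'a \<Rightarrow> 'a" where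
  "contract_vert X S v = (if v \<in> verts S then closest X (verts S) else v)"

definition contract ::
    "('a, 'b) rooted_digraph \<Rightarrow> ('a, 'b) pre_digraph \<Rightarrow> ('a, 'b) rooted_digraph" where
  "contract X S =
     \<lparr> graph_of =
         \<lparr> verts = contract_vert X S ` rverts X,
           arcs = rarcs X - arcs S,
           tail = contract_vert X S \<circ> tail (graph_of X),
           head = contract_vert X S \<circ> head (graph_of X) \<rparr>,
       root_of = contract_vert X S (root_of X) \<rparr>"


section \<open>Isomorphism classes of rooted trees\<close>

lemma rooted_iso_refl: "rooted_tree X \<Longrightarrow> rooted_iso X X"
  unfolding rooted_iso_def rooted_tree_def
  by (intro exI[of _ "\<lparr> iso_verts = id, iso_arcs = id,
        iso_head = head (graph_of X), iso_tail = tail (graph_of X) \<rparr>"])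
     (auto simp: pre_digraph.digraph_isomorphism_def app_iso_def fin_digraph_def)

lemma rooted_iso_sym:
  assumes "rooted_tree X" "rooted_iso X Y" shows "rooted_iso Y X"
proof -
  obtain f where f: "pre_digraph.digraph_isomorphism (graph_of X) f"
    "graph_of Y = app_iso f (graph_of X)" "root_of Y = iso_verts f (root_of X)"
    using assms(2) by (auto simp: rooted_iso_def)
  interpret fin_digraph "graph_of X" using assms(1) by (simp add: rooted_tree_def)
  have "root_of X \<in> rverts X" using assms(1) by (simp add: rooted_tree_def)
  then show ?thesis unfolding rooted_iso_def
    using f digraph_isomorphism_invI[OF f(1)]
    by (intro exI[of _ "pre_digraph.inv_iso (graph_of X) f"]) simp
qed

lemma rooted_iso_trans:
  assumes "rooted_iso X Y" "rooted_iso Y Z" shows "rooted_iso X Z"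
proof -
  obtain f where f: "pre_digraph.digraph_isomorphism (graph_of X) f"
    "graph_of Y = app_iso f (graph_of X)" "root_of Y = iso_verts f (root_of X)"
    using assms(1) by (auto simp: rooted_iso_def)
  obtain g where g: "pre_digraph.digraph_isomorphism (graph_of Y) g"
    "graph_of Z = app_iso g (graph_of Y)" "root_of Z = iso_verts g (root_of Y)"
    using assms(2) by (auto simp: rooted_iso_def)
  let ?h = "\<lparr> iso_verts = iso_verts g \<circ> iso_verts f, iso_arcs = iso_arcs g \<circ> iso_arcs f,
              iso_head = iso_head g, iso_tail = iso_tail g \<rparr>"
  have "pre_digraph.digraph_isomorphism (graph_of X) ?h"
    using f(1) g(1) unfolding f(2) pre_digraph.digraph_isomorphism_def
    by (auto intro: comp_inj_on)
  moreover have "graph_of Z = app_iso ?h (graph_of X)"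
    unfolding g(2) f(2) by (simp add: app_iso_def image_comp)
  ultimately show ?thesis unfolding rooted_iso_def using f(3) g(3) by auto
qed

definition rtree_eq :: "(nat, nat) rooted_digraph \<Rightarrow> (nat, nat) rooted_digraph \<Rightarrow> bool" where
  "rtree_eq X Y \<longleftrightarrow> rooted_tree X \<and> rooted_tree Y \<and> rooted_iso X Y"

definition single_vertex :: "(nat, nat) rooted_digraph" where
  "single_vertex =
     \<lparr> graph_of = \<lparr> verts = {0}, arcs = {}, tail = (\<lambda>_. 0), head = (\<lambda>_. 0) \<rparr>, root_of = 0 \<rparr>"

lemma rooted_tree_single_vertex: "rooted_tree single_vertex"
  by (auto simp: rooted_tree_def single_vertex_def pre_digraph.awalk_def
      pre_digraph.cas.simps intro!: ex1I[of _ "[]"] fin_digraph.intro wf_digraph.intro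
      fin_digraph_axioms.intro)

text \<open>Since trees are finite, vertices and arcs taken from the naturals realise every isomorphism class.\<close>

quotient_type rtree = "(nat, nat) rooted_digraph" / partial: rtree_eq
proof (rule part_equivpI)
  show "\<exists>X. rtree_eq X X"
    using rooted_tree_single_vertex rooted_iso_refl by (auto simp: rtree_eq_def)
  show "symp rtree_eq"
    by (auto intro!: sympI simp: rtree_eq_def rooted_iso_sym)
  show "transp rtree_eq"
    by (auto intro!: transpI simp: rtree_eq_def intro: rooted_iso_trans)
qed

lemma rtree_eq_rep: "rtree_eq (rep_rtree x) (rep_rtree x)"
  using Quotient_rtree by (simp add: Quotient_rep_reflp)

lemma rooted_tree_rep: "rooted_tree (rep_rtree x)"
  using rtree_eq_rep by (simp add: rtree_eq_def)

text \<open>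
  The numbers of cuts and subtrees are invariant under isomorphism, so they may be computed on
  representatives.
\<close>

definition cut_number :: "rtree \<Rightarrow> rtree \<Rightarrow> rtree \<Rightarrow> nat" where
  "cut_number t t' x =
     card {c \<in> rarcs (rep_rtree x).
             rooted_iso (branch (rep_rtree x) c) (rep_rtree t) \<and>
             rooted_iso (trunk (rep_rtree x) c) (rep_rtree t')}"

definition subtree_number :: "rtree \<Rightarrow> rtree \<Rightarrow> rtree \<Rightarrow> nat" where
  "subtree_number t t' x =
     card {S \<in> subtrees (rep_rtree x).
             rooted_iso (root_subtree (rep_rtree x) S) (rep_rtree t) \<and>
             rooted_iso (contract (rep_rtree x) S) (rep_rtree t')}"

definition has_edge :: "rtree \<Rightarrow> bool" where
  "has_edge t \<longleftrightarrow> rarcs (rep_rtree t) \<noteq> {}"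


section \<open>The sums defining the two laws are finite\<close>

lemma inj_on_head:
  assumes "rooted_tree X" shows "inj_on (head (graph_of X)) (rarcs X)"
proof (rule inj_onI)
  fix a b assume a: "a \<in> rarcs X" and b: "b \<in> rarcs X"
    and eq: "head (graph_of X) a = head (graph_of X) b"
  interpret fin_digraph "graph_of X" using assms by (simp add: rooted_tree_def)
  have ex1: "\<exists>!p. awalk (root_of X) p v" if "v \<in> rverts X" for v
    using assms that by (simp add: rooted_tree_def)
  obtain p q where p: "awalk (root_of X) p (tail (graph_of X) a)"
    and q: "awalk (root_of X) q (tail (graph_of X) b)"
    using ex1[of "tail (graph_of X) a"] ex1[of "tail (graph_of X) b"] a b by auto
  have "awalk (root_of X) (p @ [a]) (head (graph_of X) a)"
    using awalk_appendI[OF p] arc_implies_awalk[OF a] by blast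
  moreover have "awalk (root_of X) (q @ [b]) (head (graph_of X) a)"
    using awalk_appendI[OF q] arc_implies_awalk[OF b] eq by auto
  ultimately have "p @ [a] = q @ [b]" using ex1[OF head_in_verts[OF a]] by blast
  then show "a = b" by simp
qed

lemma rooted_iso_card:
  "rooted_iso X Y \<Longrightarrow> card (rverts X) = card (rverts Y)"
  by (auto simp: rooted_iso_def pre_digraph.digraph_isomorphism_def card_image)

lemma rooted_iso_finite:
  assumes "rooted_iso X Y" "rooted_tree Y" shows "finite (rverts X)"
proof -
  have "finite (rverts Y)"
    using assms(2) by (simp add: rooted_tree_def fin_digraph.finite_verts)
  then show ?thesis
    using assms(1) by (auto simp: rooted_iso_def pre_digraph.digraph_isomorphism_def
        dest: finite_imageD)
qed

lemma rooted_tree_iso: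
  assumes "rooted_tree X" "rooted_iso X Y" shows "rooted_tree Y"
proof -
  obtain f where f: "pre_digraph.digraph_isomorphism (graph_of X) f"
    "graph_of Y = app_iso f (graph_of X)" "root_of Y = iso_verts f (root_of X)"
    using assms(2) by (auto simp: rooted_iso_def)
  interpret X: fin_digraph "graph_of X" using assms(1) by (simp add: rooted_tree_def)
  interpret Y: fin_digraph "graph_of Y"
    using X.fin_digraphI_app_iso[OF f(1)] by (simp add: f(2))
  let ?g = "pre_digraph.inv_iso (graph_of X) f"
  have g: "pre_digraph.digraph_isomorphism (graph_of Y) ?g"
    using X.digraph_isomorphism_invI[OF f(1)] by (simp add: f(2))
  have inv: "app_iso ?g (graph_of Y) = graph_of X" using f by simp
  have r: "root_of X \<in> rverts X" using assms(1) by (simp add: rooted_tree_def)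
  have ex1: "\<exists>!p. X.awalk (root_of X) p v" if "v \<in> rverts X" for v
    using assms(1) that by (simp add: rooted_tree_def)
  have "\<exists>!p. Y.awalk (root_of Y) p w" if w: "w \<in> rverts Y" for w
  proof -
    obtain v where v: "v \<in> rverts X" "w = iso_verts f v" using w f(2) by auto
    obtain p where p: "X.awalk (root_of X) p v" using ex1[OF v(1)] by auto
    have "Y.awalk (root_of Y) (map (iso_arcs f) p) w"
      using X.awalk_app_isoI[OF p f(1)] by (simp add: f v)
    moreover have "q = q'" if q: "Y.awalk (root_of Y) q w" and q': "Y.awalk (root_of Y) q' w" for q q'
    proof -
      have "X.awalk (root_of X) (map (iso_arcs ?g) q) v"
        using Y.awalk_app_isoI[OF q g] f r v unfolding inv by simp
      moreover have "X.awalk (root_of X) (map (iso_arcs ?g) q') v"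
        using Y.awalk_app_isoI[OF q' g] f r v unfolding inv by simp
      ultimately have "map (iso_arcs ?g) q = map (iso_arcs ?g) q'" using ex1[OF v(1)] by auto
      moreover have "set q \<subseteq> rarcs Y" "set q' \<subseteq> rarcs Y"
        using q q' by (auto simp: Y.awalk_def)
      moreover have "inj_on (iso_arcs ?g) (rarcs Y)"
        using g by (simp add: pre_digraph.digraph_isomorphism_def)
      ultimately show "q = q'"
        by (intro map_inj_on[of "iso_arcs ?g"]) (auto elim: inj_on_subset)
    qed
    ultimately show ?thesis by blast
  qed
  then show ?thesis using r f(2,3) Y.fin_digraph unfolding rooted_tree_def by simp
qed

lemma finite_rtrees: "finite {x. card (rverts (rep_rtree x)) \<le> n}"
proof -
  define F :: "(nat \<Rightarrow> nat) set" where "F = {f. \<forall>i. f i < Suc n \<and> (n \<le> i \<longrightarrow> f i = 0)}"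
  define D :: "(nat, nat) rooted_digraph set" where
    "D = (\<lambda>(V, A, t, h, r). \<lparr> graph_of = \<lparr> verts = V, arcs = A, tail = t, head = h \<rparr>, root_of = r \<rparr>) `
           (Pow {..<n} \<times> Pow {..<n} \<times> F \<times> F \<times> {..<n})"
  have "finite F"
  proof (rule finite_subset)
    show "F \<subseteq> {f. f ` {..<n} \<subseteq> {..<Suc n} \<and> (\<forall>x. x \<notin> {..<n} \<longrightarrow> f x = 0)}"
      by (auto simp: F_def)
    show "finite {f. f ` {..<n} \<subseteq> {..<Suc n} \<and> (\<forall>x. x \<notin> {..<n} \<longrightarrow> f x = (0::nat))}"
      using finite_set_of_finite_funs[of "{..<n}" "{..<Suc n}" "0::nat"]
      by (rule rev_finite_subset) (auto simp: image_subset_iff)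
  qed
  then have finD: "finite D" unfolding D_def by auto
  have "x \<in> abs_rtree ` D" if x: "card (rverts (rep_rtree x)) \<le> n" for x
  proof -
    let ?X = "rep_rtree x"
    have T: "rooted_tree ?X" by (rule rooted_tree_rep)
    interpret fin_digraph "graph_of ?X" using T by (simp add: rooted_tree_def)
    have r: "root_of ?X \<in> rverts ?X" using T by (simp add: rooted_tree_def)
    have "card (rarcs ?X) \<le> card (rverts ?X)"
      using inj_on_head[OF T] by (rule card_inj_on_le) auto
    then have "card (rarcs ?X) \<le> card {..<n}" using x by simp
    then obtain fa where fa: "inj_on fa (rarcs ?X)" "fa ` rarcs ?X \<subseteq> {..<n}"
      using card_le_inj[OF finite_arcs finite_lessThan] by blast
    have "card (rverts ?X) \<le> card {..<n}" using x by simp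
    then obtain fv where fv: "inj_on fv (rverts ?X)" "fv ` rverts ?X \<subseteq> {..<n}"
      using card_le_inj[OF finite_verts finite_lessThan] by blast
    let ?e = "the_inv_into (rarcs ?X) fa"
    define t where "t i = (if i \<in> fa ` rarcs ?X then fv (tail (graph_of ?X) (?e i)) else 0)" for i
    define h where "h i = (if i \<in> fa ` rarcs ?X then fv (head (graph_of ?X) (?e i)) else 0)" for i
    let ?f = "\<lparr> iso_verts = fv, iso_arcs = fa, iso_head = h, iso_tail = t \<rparr>"
    let ?Y = "\<lparr> graph_of = app_iso ?f (graph_of ?X), root_of = fv (root_of ?X) \<rparr>"
    have "digraph_isomorphism ?f"
      unfolding digraph_isomorphism_def using fa(1) fv(1) wf_digraph
      by (auto simp: t_def h_def the_inv_into_f_f)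
    then have iso: "rooted_iso ?X ?Y" unfolding rooted_iso_def by force
    have "rtree_eq ?Y ?X"
      using T rooted_tree_iso[OF T iso] rooted_iso_sym[OF T iso] by (simp add: rtree_eq_def)
    then have "abs_rtree ?Y = x"
      using Quotient_rel_abs[OF Quotient_rtree, of ?Y ?X] Quotient_abs_rep[OF Quotient_rtree, of x]
      by simp
    moreover have "?Y \<in> D"
    proof -
      have v: "fv v < n" if "v \<in> rverts ?X" for v using fv(2) that by auto
      have a: "fa i < n" if "i \<in> rarcs ?X" for i using fa(2) that by auto
      have "t \<in> F" "h \<in> F"
        unfolding F_def t_def h_def using a v
      by (auto simp: the_inv_into_f_f[OF fa(1)] less_SucI dest!: leD)
      then show ?thesis unfolding D_def using fv fa v[OF r]
        by (intro image_eqI[of _ _ "(fv ` rverts ?X, fa ` rarcs ?X, t, h, fv (root_of ?X))"])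
           (auto simp: app_iso_def)
    qed
    ultimately show ?thesis using imageI[of ?Y D abs_rtree] by simp
  qed
  then have "{x. card (rverts (rep_rtree x)) \<le> n} \<subseteq> abs_rtree ` D" by auto
  then show ?thesis using finD by (rule finite_subset[OF _ finite_imageI])
qed

lemma finite_cut_support: "finite {x. cut_number t t' x \<noteq> 0}"
proof (rule finite_subset[OF _ finite_rtrees])
  show "{x. cut_number t t' x \<noteq> 0}
     \<subseteq> {x. card (rverts (rep_rtree x)) \<le> card (rverts (rep_rtree t')) + card (rverts (rep_rtree t))}"
  proof safe
    fix x assume "0 < cut_number t t' x"
    then obtain c where c: "rooted_iso (branch (rep_rtree x) c) (rep_rtree t)"
      "rooted_iso (trunk (rep_rtree x) c) (rep_rtree t')"
      unfolding cut_number_def by (auto simp: card_gt_0_iff)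
    interpret fin_digraph "graph_of (rep_rtree x)"
      using rooted_tree_rep[of x] by (simp add: rooted_tree_def)
    have "rverts (rep_rtree x) \<subseteq> rverts (trunk (rep_rtree x) c) \<union> rverts (branch (rep_rtree x) c)"
      by (auto simp: trunk_def branch_def Let_def)
    moreover have "finite (rverts (trunk (rep_rtree x) c))" "finite (rverts (branch (rep_rtree x) c))"
      using c rooted_tree_rep by (blast intro: rooted_iso_finite)+
    ultimately have "card (rverts (rep_rtree x))
        \<le> card (rverts (trunk (rep_rtree x) c)) + card (rverts (branch (rep_rtree x) c))"
      by (meson card_Un_le card_mono finite_UnI le_trans)
    then show "card (rverts (rep_rtree x)) \<le> card (rverts (rep_rtree t')) + card (rverts (rep_rtree t))"
      using c by (simp add: rooted_iso_card)
  qed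
qed

lemma finite_subtree_support: "finite {x. subtree_number t t' x \<noteq> 0}"
proof (rule finite_subset[OF _ finite_rtrees])
  show "{x. subtree_number t t' x \<noteq> 0}
     \<subseteq> {x. card (rverts (rep_rtree x)) \<le> card (rverts (rep_rtree t')) + card (rverts (rep_rtree t))}"
  proof safe
    fix x assume "0 < subtree_number t t' x"
    then obtain S where S: "S \<in> subtrees (rep_rtree x)"
      "rooted_iso (root_subtree (rep_rtree x) S) (rep_rtree t)"
      "rooted_iso (contract (rep_rtree x) S) (rep_rtree t')"
      unfolding subtree_number_def by (auto simp: card_gt_0_iff)
    interpret fin_digraph "graph_of (rep_rtree x)"
      using rooted_tree_rep[of x] by (simp add: rooted_tree_def)
    have sub: "verts S \<subseteq> rverts (rep_rtree x)" using S(1) by (auto simp: subtrees_def)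
    have "rverts (rep_rtree x) \<subseteq> rverts (contract (rep_rtree x) S) \<union> verts S"
      by (auto simp: contract_def contract_vert_def image_iff)
    moreover have "finite (verts S)" "finite (rverts (contract (rep_rtree x) S))"
      using finite_subset[OF sub finite_verts] by (simp_all add: contract_def)
    ultimately have "card (rverts (rep_rtree x))
        \<le> card (rverts (contract (rep_rtree x) S)) + card (verts S)"
      by (meson card_Un_le card_mono finite_UnI le_trans)
    then show "card (rverts (rep_rtree x)) \<le> card (rverts (rep_rtree t')) + card (rverts (rep_rtree t))"
      using rooted_iso_card[OF S(2)] rooted_iso_card[OF S(3)] by (simp add: root_subtree_def)
  qed
qed


section \<open>The vector space of rooted trees and the two laws\<close>

definition tree_scale :: "'k::field \<Rightarrow> (rtree \<Rightarrow>\<^sub>0 'k) \<Rightarrow> (rtree \<Rightarrow>\<^sub>0 'k)" where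
  "tree_scale a f = Poly_Mapping.map ((*) a) f"

lemma lookup_tree_scale [simp]:
  "Poly_Mapping.lookup (tree_scale a f) x = a * Poly_Mapping.lookup f x"
  by (simp add: tree_scale_def Poly_Mapping.map.rep_eq when_def)

lemma vector_space_tree_scale: "vector_space (tree_scale :: 'k::field \<Rightarrow> _)"
  by unfold_locales (auto intro!: poly_mapping_eqI simp: lookup_add algebra_simps)

definition nontrivial_trees :: "(rtree \<Rightarrow>\<^sub>0 'k::field) set" where
  "nontrivial_trees = module.span tree_scale ((\<lambda>t. Poly_Mapping.single t 1) ` {t. has_edge t})"

definition bilinear_extension ::
    "(rtree \<Rightarrow> rtree \<Rightarrow> (rtree \<Rightarrow>\<^sub>0 'k::field)) \<Rightarrow>
     (rtree \<Rightarrow>\<^sub>0 'k) \<Rightarrow> (rtree \<Rightarrow>\<^sub>0 'k) \<Rightarrow> (rtree \<Rightarrow>\<^sub>0 'k)" where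
  "bilinear_extension b u v =
     (\<Sum>t \<in> Poly_Mapping.keys u. \<Sum>t' \<in> Poly_Mapping.keys v.
        tree_scale (Poly_Mapping.lookup u t * Poly_Mapping.lookup v t') (b t t'))"

definition graft :: "(rtree \<Rightarrow>\<^sub>0 'k::field) \<Rightarrow> (rtree \<Rightarrow>\<^sub>0 'k) \<Rightarrow> (rtree \<Rightarrow>\<^sub>0 'k)" where
  "graft = bilinear_extension
     (\<lambda>t t'. \<Sum>x | cut_number t t' x \<noteq> 0. Poly_Mapping.single x (of_nat (cut_number t t' x)))"

text \<open>
  The insertion law is only meaningful when its first argument lies in \<^const>\<open>nontrivial_trees\<close>.
\<close>

definition insertion :: "(rtree \<Rightarrow>\<^sub>0 'k::field) \<Rightarrow> (rtree \<Rightarrow>\<^sub>0 'k) \<Rightarrow> (rtree \<Rightarrow>\<^sub>0 'k)" where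
  "insertion = bilinear_extension
     (\<lambda>t t'. \<Sum>x | subtree_number t t' x \<noteq> 0.
        Poly_Mapping.single x (of_nat (subtree_number t t' x)))"

end

theory Submission
  imports Defs
begin

text \<open>
  Both sides are compared coefficient by coefficient, at a tree \<open>x\<close> and for basis trees \<open>t\<close>, \<open>u\<close>,
  \<open>v\<close>.  On the left one chooses a subtree \<open>S\<close> of \<open>x\<close> isomorphic to \<open>t\<close> and then cuts an edge of
  \<open>x/S\<close>, that is, an edge \<open>c\<close> of \<open>x\<close> outside \<open>S\<close>.  Since \<open>S\<close> is connected and avoids \<open>c\<close>, it lies
  entirely in the branch or entirely in the trunk of \<open>x\<close> at \<open>c\<close>.  In the first case the branch of
  \<open>x/S\<close> at \<open>c\<close> is the contraction by \<open>S\<close> of the branch of \<open>x\<close>, and the trunk is unchanged: such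
  pairs are counted by the coefficient of the graft of \<open>t \<triangleright> u\<close> on \<open>v\<close>.  In the second case the roles
  are exchanged and the pairs are counted by the coefficient of the graft of \<open>u\<close> on \<open>t \<triangleright> v\<close>.  So the
  pairs \<open>(S, c)\<close> on the left are the disjoint union of those on the right; this is
  \<open>contract_cut_pairs\<close>, resting on \<open>subtree_in_one_part\<close>, \<open>subtree_of_branch\<close> and
  \<open>subtree_of_trunk\<close>.

  To argue this way with graphs, a rooted tree is described as an arborescence
  (\<open>rooted_tree_iff\<close>).  The branch at an arc then consists of the descendants of its head
  (\<open>branch_eq\<close>, \<open>trunk_eq\<close>), and a subtree is a subgraph with a vertex that reaches all of it by
  directed walks (\<open>subtrees_iff\<close>).  With these descriptions most of the isomorphisms above become
  equalities of graphs.

  Each side of the identity sums over an intermediate isomorphism class, namely that of \<open>x/S\<close>, of the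
  branch or of the trunk, and counts inside a chosen representative of it.  That these numbers may
  be taken on the concrete graph is their invariance under isomorphism (\<open>card_cuts_iso\<close>,
  \<open>card_insertions_iso\<close>).  The identity between coefficients is \<open>structure_constants\<close>, and the theorem
  follows by bilinearity.
\<close>

section \<open>Arborescences\<close>

lemma reach_arc_induct [consumes 2, case_names base arc]:
  assumes "wf_digraph G" "u \<rightarrow>\<^sup>*\<^bsub>G\<^esub> v" "P u"
    "\<And>a. a \<in> arcs G \<Longrightarrow> u \<rightarrow>\<^sup>*\<^bsub>G\<^esub> tail G a \<Longrightarrow> P (tail G a) \<Longrightarrow> P (head G a)"
  shows "P v"
proof -
  interpret wf_digraph G by fact
  show ?thesis using assms(2)
    by (induct rule: reachable_induct) (use assms(3,4) in auto)
qed

lemma reach_arc_trans: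
  assumes "wf_digraph G" "u \<rightarrow>\<^sup>*\<^bsub>G\<^esub> tail G a" "a \<in> arcs G"
  shows "u \<rightarrow>\<^sup>*\<^bsub>G\<^esub> head G a"
proof -
  interpret wf_digraph G by fact
  show ?thesis using assms(2,3) by (meson in_arcs_imp_in_arcs_ends reachable_adj_trans)
qed

lemma reach_last_arc:
  assumes "wf_digraph G" "u \<rightarrow>\<^sup>*\<^bsub>G\<^esub> v"
  shows "v = u \<or> (\<exists>a \<in> arcs G. head G a = v \<and> u \<rightarrow>\<^sup>*\<^bsub>G\<^esub> tail G a)"
  using assms by (induct rule: reach_arc_induct) auto

lemma mk_symmetric_reach_induct [consumes 2, case_names base forward backward]:
  assumes "wf_digraph G" "u \<rightarrow>\<^sup>*\<^bsub>with_proj (mk_symmetric G)\<^esub> v"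
    and "P u"
    and "\<And>a. a \<in> arcs G \<Longrightarrow> P (tail G a) \<Longrightarrow> P (head G a)"
    and "\<And>a. a \<in> arcs G \<Longrightarrow> P (head G a) \<Longrightarrow> P (tail G a)"
  shows "P v"
proof -
  interpret S: pair_wf_digraph "mk_symmetric G"
    using wf_digraph.wellformed_mk_symmetric[OF assms(1)] .
  show ?thesis using assms(2)
    by (induct rule: S.reachable_induct)
       (use assms(3-) in \<open>auto simp: parcs_mk_symmetric\<close>)
qed

lemma reach_imp_mk_symmetric:
  assumes "wf_digraph G" "u \<rightarrow>\<^sup>*\<^bsub>G\<^esub> v"
  shows "u \<rightarrow>\<^sup>*\<^bsub>with_proj (mk_symmetric G)\<^esub> v" "v \<rightarrow>\<^sup>*\<^bsub>with_proj (mk_symmetric G)\<^esub> u"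
  using wf_digraph.reachable_mk_symmetricI[OF assms]
  by (auto intro: symmetric_reachable[OF symmetric_mk_symmetric])

text \<open>
  Uniqueness of walks from the root is awkward to check for a newly built graph.  The conditions
  below say the same locally: every vertex is reached, and no vertex is entered by two arcs, the
  root by none.
\<close>

locale arborescence = fin_digraph G for G :: "('a, 'b) pre_digraph" +
  fixes r :: 'a
  assumes root_in_verts: "r \<in> verts G"
    and root_reaches: "\<And>v. v \<in> verts G \<Longrightarrow> r \<rightarrow>\<^sup>*\<^bsub>G\<^esub> v"
    and inj_head: "inj_on (head G) (arcs G)"
    and head_neq_root: "\<And>a. a \<in> arcs G \<Longrightarrow> head G a \<noteq> r"
begin

lemma reach_head_cases:
  assumes "u \<rightarrow>\<^sup>*\<^bsub>G\<^esub> head G a" "a \<in> arcs G"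
  shows "u = head G a \<or> u \<rightarrow>\<^sup>*\<^bsub>G\<^esub> tail G a"
  using reach_last_arc[OF wf_digraph_axioms assms(1)] inj_head assms(2) by (auto dest: inj_onD)

lemma reach_root: "u \<rightarrow>\<^sup>*\<^bsub>G\<^esub> r \<Longrightarrow> u = r"
  using reach_last_arc[OF wf_digraph_axioms, of u r] head_neq_root by auto

text \<open>
  A directed cycle could be followed backwards to the root, which no arc enters; the induction runs
  along the walk from the root to the tail of the arc.
\<close>

lemma head_not_reach_tail:
  assumes "a \<in> arcs G" shows "\<not> head G a \<rightarrow>\<^sup>*\<^bsub>G\<^esub> tail G a"
proof -
  have "r \<rightarrow>\<^sup>*\<^bsub>G\<^esub> tail G a" using assms root_reaches by simp
  with wf_digraph_axioms have "\<forall>b \<in> arcs G. tail G b = tail G a \<longrightarrow> \<not> head G b \<rightarrow>\<^sup>*\<^bsub>G\<^esub> tail G b"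
  proof (induct rule: reach_arc_induct)
    case base
    then show ?case using reach_root head_neq_root by metis
  next
    case (arc e)
    show ?case
    proof (intro ballI impI notI)
      fix b assume b: "b \<in> arcs G" "tail G b = head G e" "head G b \<rightarrow>\<^sup>*\<^bsub>G\<^esub> tail G b"
      then consider "head G b = head G e" | "head G b \<rightarrow>\<^sup>*\<^bsub>G\<^esub> tail G e"
        using reach_head_cases[of "head G b" e] arc(1) by auto
      then show False
      proof cases
        case 1
        then have "b = e" using inj_head b(1) arc(1) by (auto dest: inj_onD)
        then show False using arc b by metis
      next
        case 2
        then have "tail G b \<rightarrow>\<^sup>*\<^bsub>G\<^esub> tail G e"
          using b(1) by (meson adj_reachable_trans in_arcs_imp_in_arcs_ends)
        then show False using arc b(2) by metis
      qed
    qed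
  qed
  then show ?thesis using assms by blast
qed

text \<open>Tracing a walk backwards from its end leaves no choice, because heads are unique.\<close>

lemma awalk_root_unique:
  assumes "awalk r p v" "awalk r q v" shows "p = q"
  using assms
proof (induct p arbitrary: q v rule: rev_induct)
  case Nil
  then have v: "v = r" by (auto simp: awalk_Nil_iff)
  show ?case
  proof (cases q rule: rev_cases)
    case (snoc q' b)
    then have "b \<in> arcs G" "head G b = v"
      using Nil(2) by (auto simp: awalk_Cons_iff awalk_Nil_iff)
    then show ?thesis using v head_neq_root by blast
  qed simp
next
  case (snoc a p)
  then have a: "a \<in> arcs G" "head G a = v" "awalk r p (tail G a)"
    by (auto simp: awalk_Cons_iff awalk_Nil_iff)
  show ?case
  proof (cases q rule: rev_cases)
    case Nil
    then show ?thesis using snoc.prems a head_neq_root by (auto simp: awalk_Nil_iff)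
  next
    case (snoc q' b)
    then have b: "b \<in> arcs G" "head G b = v" "awalk r q' (tail G b)"
      using snoc.prems(2) by (auto simp: awalk_Cons_iff awalk_Nil_iff)
    then have "a = b" using a inj_head by (auto dest: inj_onD)
    then show ?thesis using snoc.hyps[OF a(3)] b snoc by auto
  qed
qed

end

lemma rooted_tree_iff: "rooted_tree X \<longleftrightarrow> arborescence (graph_of X) (root_of X)"
proof
  assume X: "rooted_tree X"
  interpret fin_digraph "graph_of X" using X by (simp add: rooted_tree_def)
  have r: "root_of X \<in> rverts X" using X by (simp add: rooted_tree_def)
  have ex1: "\<exists>!p. awalk (root_of X) p v" if "v \<in> rverts X" for v
    using X that by (simp add: rooted_tree_def)
  have reach: "root_of X \<rightarrow>\<^sup>*\<^bsub>graph_of X\<^esub> v" if "v \<in> rverts X" for v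
    using ex1[OF that] by (auto simp: reachable_awalk)
  show "arborescence (graph_of X) (root_of X)"
  proof
    fix a assume a: "a \<in> rarcs X"
    show "head (graph_of X) a \<noteq> root_of X"
    proof
      assume eq: "head (graph_of X) a = root_of X"
      obtain p where "awalk (root_of X) p (tail (graph_of X) a)"
        using ex1[of "tail (graph_of X) a"] a by auto
      then have "awalk (root_of X) (p @ [a]) (root_of X)"
        using awalk_appendI arc_implies_awalk[OF a] eq by metis
      moreover have "awalk (root_of X) [] (root_of X)" using r by (simp add: awalk_Nil_iff)
      ultimately show False using ex1[OF r] by blast
    qed
  qed (use r reach inj_on_head[OF X] in auto)
next
  assume "arborescence (graph_of X) (root_of X)"
  then interpret arborescence "graph_of X" "root_of X" .
  have "\<exists>!p. awalk (root_of X) p v" if "v \<in> rverts X" for v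
    using root_reaches[OF that] awalk_root_unique by (auto simp: reachable_awalk)
  then show "rooted_tree X"
    using fin_digraph_axioms root_in_verts by (simp add: rooted_tree_def)
qed

text \<open>
  The depth of \<open>w\<close> is the depth of \<open>s\<close> plus the length of a walk from \<open>s\<close> to \<open>w\<close>, so \<open>s\<close> is the
  only vertex of least depth and the choice hidden in \<^const>\<open>closest\<close> is determined.
\<close>

lemma closest_eqI:
  assumes X: "rooted_tree X" and s: "s \<in> W" and W: "\<And>w. w \<in> W \<Longrightarrow> s \<rightarrow>\<^sup>*\<^bsub>graph_of X\<^esub> w"
  shows "closest X W = s"
proof -
  interpret arborescence "graph_of X" "root_of X" using X by (simp add: rooted_tree_iff)
  have depth: "depth X v = length p" if "awalk (root_of X) p v" for p v
    unfolding depth_def using that awalk_root_unique by (intro Least_equality) auto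
  have "s \<in> rverts X" using W[OF s] by (meson reachable_in_verts)
  then obtain p where p: "awalk (root_of X) p s"
    using root_reaches by (auto simp: reachable_awalk)
  have less: "depth X s < depth X w" if w: "w \<in> W" "w \<noteq> s" for w
  proof -
    obtain q where q: "awalk s q w" using W[OF w(1)] by (auto simp: reachable_awalk)
    then have "q \<noteq> []" using w(2) by (auto simp: awalk_Nil_iff)
    then show ?thesis using depth[OF p] depth[OF awalk_appendI[OF p q]] by simp
  qed
  have "is_arg_min (depth X) (\<lambda>w. w \<in> W) w \<longleftrightarrow> w = s" for w
    using less s by (auto simp: is_arg_min_def) (metis less_asym)+
  then show ?thesis by (simp add: closest_def arg_min_def)
qed

section \<open>Trunk and branch\<close>

definition descendants :: "('a, 'b) pre_digraph \<Rightarrow> 'a \<Rightarrow> 'a set" where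
  "descendants G v = {w. v \<rightarrow>\<^sup>*\<^bsub>G\<^esub> w}"

context arborescence begin

lemma descendants_subset: "descendants G v \<subseteq> verts G"
  unfolding descendants_def by (auto dest: reachable_in_verts)

lemma head_in_descendants: "a \<in> arcs G \<Longrightarrow> head G a \<in> descendants G (head G a)"
  by (simp add: descendants_def)

lemma root_notin_descendants: "c \<in> arcs G \<Longrightarrow> r \<notin> descendants G (head G c)"
  using reach_root head_neq_root by (auto simp: descendants_def)

lemma tail_notin_descendants: "c \<in> arcs G \<Longrightarrow> tail G c \<notin> descendants G (head G c)"
  using head_not_reach_tail by (simp add: descendants_def)

text \<open>
  Into the branch one can only come through its root, and no arc other than \<open>c\<close> enters that root.
\<close>

lemma descendants_arc_iff:
  assumes "c \<in> arcs G" "a \<in> arcs G" "a \<noteq> c"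
  shows "head G a \<in> descendants G (head G c) \<longleftrightarrow> tail G a \<in> descendants G (head G c)"
proof -
  have "head G a \<noteq> head G c" using assms inj_head by (auto dest: inj_onD)
  then show ?thesis unfolding descendants_def
    using reach_head_cases[of "head G c" a] reach_arc_trans[OF wf_digraph_axioms _ assms(2)] assms(2)
    by auto
qed

text \<open>
  The walk from the root to a vertex \<open>w\<close> outside the branch stays outside it: once inside, it could
  not leave, and \<open>w\<close> would be a descendant of the head of \<open>c\<close>.
\<close>

lemma reach_avoiding_branch:
  assumes c: "c \<in> arcs G" and w: "w \<in> verts G - descendants G (head G c)"
  shows "r \<rightarrow>\<^sup>*\<^bsub>del_arc c \<restriction> (verts G - descendants G (head G c))\<^esub> w"
proof -
  let ?T = "verts G - descendants G (head G c)"
  have wf: "wf_digraph (del_arc c \<restriction> ?T)" by (auto simp: wf_digraph_def)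
  have "r \<rightarrow>\<^sup>*\<^bsub>G\<^esub> w" using w root_reaches by simp
  with wf_digraph_axioms have "w \<in> ?T \<longrightarrow> r \<rightarrow>\<^sup>*\<^bsub>del_arc c \<restriction> ?T\<^esub> w"
  proof (induct rule: reach_arc_induct)
    case base
    then show ?case by (auto intro: wf_digraph.reachable_refl[OF wf])
  next
    case (arc a)
    show ?case
    proof
      assume a: "head G a \<in> ?T"
      then have "a \<noteq> c" using head_in_descendants arc by blast
      then show "r \<rightarrow>\<^sup>*\<^bsub>del_arc c \<restriction> ?T\<^esub> head G a"
        using reach_arc_trans[OF wf, of r a] arc descendants_arc_iff[OF c] a by auto
    qed
  qed
  then show ?thesis using w by blast
qed

lemma component_verts_del_arc:
  assumes c: "c \<in> arcs G"
  shows "component_verts (del_arc c) r = verts G - descendants G (head G c)" (is "_ = ?T")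
proof -
  interpret D: wf_digraph "del_arc c" by (rule wf_digraph_del_arc)
  show ?thesis
  proof (intro equalityI subsetI)
    fix w assume "w \<in> component_verts (del_arc c) r"
    then have "r \<rightarrow>\<^sup>*\<^bsub>with_proj (mk_symmetric (del_arc c))\<^esub> w" by (simp add: component_verts_def)
    with D.wf_digraph_axioms show "w \<in> ?T"
      by (induct rule: mk_symmetric_reach_induct)
         (use root_in_verts root_notin_descendants[OF c] descendants_arc_iff[OF c] in auto)
  next
    fix w assume w: "w \<in> ?T"
    have "wf_digraph (del_arc c \<restriction> ?T)" by (auto simp: wf_digraph_def)
    then have "subgraph (del_arc c \<restriction> ?T) (del_arc c)"
      using D.wf_digraph_axioms by (auto simp: subgraph_def compatible_def)
    then have "r \<rightarrow>\<^sup>*\<^bsub>del_arc c\<^esub> w"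
      using D.reachable_mono reach_avoiding_branch[OF c w] by blast
    then show "w \<in> component_verts (del_arc c) r"
      using reach_imp_mk_symmetric(1)[OF D.wf_digraph_axioms] by (simp add: component_verts_def)
  qed
qed

end

lemma trunk_eq:
  assumes X: "rooted_tree X" and c: "c \<in> rarcs X"
  shows "trunk X c = \<lparr> graph_of = pre_digraph.del_arc (graph_of X) c \<restriction>
      (rverts X - descendants (graph_of X) (head (graph_of X) c)), root_of = root_of X \<rparr>"
  using arborescence.component_verts_del_arc[OF X[unfolded rooted_tree_iff] c]
  by (simp add: trunk_def Let_def)

lemma branch_eq:
  assumes X: "rooted_tree X" and c: "c \<in> rarcs X"
  shows "branch X c = \<lparr> graph_of = pre_digraph.del_arc (graph_of X) c \<restriction>
      descendants (graph_of X) (head (graph_of X) c), root_of = head (graph_of X) c \<rparr>"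
proof -
  interpret arborescence "graph_of X" "root_of X" using X by (simp add: rooted_tree_iff)
  let ?D = "descendants (graph_of X) (head (graph_of X) c)"
  have "closest X ?D = head (graph_of X) c"
    using head_in_descendants[OF c] by (intro closest_eqI[OF X]) (auto simp: descendants_def)
  moreover have "verts (del_arc c) - component_verts (del_arc c) (root_of X) = ?D"
    using component_verts_del_arc[OF c] descendants_subset by auto
  ultimately show ?thesis by (simp add: branch_def Let_def)
qed

lemma rooted_tree_trunk:
  assumes X: "rooted_tree X" and c: "c \<in> rarcs X"
  shows "rooted_tree (trunk X c)"
proof -
  interpret arborescence "graph_of X" "root_of X" using X by (simp add: rooted_tree_iff)
  show ?thesis
    unfolding trunk_eq[OF X c] rooted_tree_iff
    using root_in_verts root_notin_descendants[OF c] inj_head head_neq_root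
      reach_avoiding_branch[OF c]
    by unfold_locales (auto simp: inj_on_def)
qed

lemma rooted_tree_branch:
  assumes X: "rooted_tree X" and c: "c \<in> rarcs X"
  shows "rooted_tree (branch X c)"
proof -
  interpret arborescence "graph_of X" "root_of X" using X by (simp add: rooted_tree_iff)
  let ?D = "descendants (graph_of X) (head (graph_of X) c)"
  let ?B = "del_arc c \<restriction> ?D"
  have wf: "wf_digraph ?B" by (auto simp: wf_digraph_def)
  have reach: "head (graph_of X) c \<rightarrow>\<^sup>*\<^bsub>?B\<^esub> v" if "v \<in> ?D" for v
  proof -
    from that have "head (graph_of X) c \<rightarrow>\<^sup>*\<^bsub>graph_of X\<^esub> v" by (simp add: descendants_def)
    with wf_digraph_axioms show ?thesis
    proof (induct rule: reach_arc_induct)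
      case base
      then show ?case using head_in_descendants[OF c] by (auto intro: wf_digraph.reachable_refl[OF wf])
    next
      case (arc a)
      then have "tail (graph_of X) a \<in> ?D" by (simp add: descendants_def)
      moreover from this have "a \<noteq> c" using tail_notin_descendants[OF c] by auto
      ultimately show ?case
        using reach_arc_trans[OF wf, of "head (graph_of X) c" a] arc descendants_arc_iff[OF c]
        by auto
    qed
  qed
  have "head (graph_of X) a \<noteq> head (graph_of X) c"
    if "a \<in> rarcs X" "a \<noteq> c" for a using that c inj_head by (auto dest: inj_onD)
  then show ?thesis
    unfolding branch_eq[OF X c] rooted_tree_iff
    using head_in_descendants[OF c] inj_head reach
      finite_subset[OF descendants_subset finite_verts]
    by unfold_locales (auto simp: inj_on_def)
qed

section \<open>Subtrees and their contraction\<close>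

text \<open>
  Reachability within \<open>S\<close> instead of undirected connectedness, with the root as an explicit witness.
\<close>

definition rooted_subgraph :: "('a, 'b) pre_digraph \<Rightarrow> ('a, 'b) pre_digraph \<Rightarrow> 'a \<Rightarrow> bool" where
  "rooted_subgraph G S s \<longleftrightarrow>
     subgraph S G \<and> arcs S \<noteq> {} \<and> s \<in> verts S \<and> (\<forall>v \<in> verts S. s \<rightarrow>\<^sup>*\<^bsub>S\<^esub> v)"

lemma rooted_subgraph_imp:
  assumes "rooted_subgraph G S s"
  shows "wf_digraph S" "verts S \<subseteq> verts G" "arcs S \<subseteq> arcs G" "tail S = tail G" "head S = head G"
  using assms by (auto simp: rooted_subgraph_def subgraph_def compatible_def)

text \<open>
  A connected subgraph has a vertex that none of its own arcs enters: going
  backwards along its arcs must stop, at the latest at the root of \<open>G\<close>.  From that vertex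
  every undirected path can be straightened to a directed one, since a backward step along an arc
  retraces the only arc that enters its head.
\<close>

lemma (in arborescence) connected_subgraph_rooted:
  assumes S: "subgraph S G" and conn: "connected S"
  obtains s where "s \<in> verts S" "\<And>v. v \<in> verts S \<Longrightarrow> s \<rightarrow>\<^sup>*\<^bsub>S\<^esub> v"
proof -
  have wf: "wf_digraph S" and arcs: "arcs S \<subseteq> arcs G" and verts: "verts S \<subseteq> verts G"
    and ends: "tail S = tail G" "head S = head G"
    using S by (auto simp: subgraph_def compatible_def)
  have same: "a = b" if "a \<in> arcs S" "b \<in> arcs G" "head S a = head S b" for a b
    using that arcs inj_head by (auto simp: ends dest: inj_onD)
  obtain v where v: "v \<in> verts S" using conn by (auto simp: connected_def strongly_connected_def)
  then have "r \<rightarrow>\<^sup>*\<^bsub>G\<^esub> v" using verts root_reaches by auto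
  with wf_digraph_axioms have "v \<in> verts S \<longrightarrow> (\<exists>s \<in> verts S. \<forall>a \<in> arcs S. head S a \<noteq> s)"
  proof (induct rule: reach_arc_induct)
    case base
    then show ?case using arcs head_neq_root by (auto simp: ends)
  next
    case (arc a)
    show ?case
    proof (cases "\<exists>b \<in> arcs S. head S b = head G a")
      case True
      then have "a \<in> arcs S" using same[of _ a] arc(1) ends by auto
      then have "tail G a \<in> verts S" using wf_digraph.tail_in_verts[OF wf] ends by auto
      then show ?thesis using arc by blast
    qed blast
  qed
  with v obtain s where s: "s \<in> verts S" "\<And>a. a \<in> arcs S \<Longrightarrow> head S a \<noteq> s" by blast
  have "s \<rightarrow>\<^sup>*\<^bsub>S\<^esub> w" if w: "w \<in> verts S" for w
  proof -
    have "s \<rightarrow>\<^sup>*\<^bsub>with_proj (mk_symmetric S)\<^esub> w"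
      using conn s(1) w by (auto simp: connected_def strongly_connected_def)
    with wf show ?thesis
    proof (induct rule: mk_symmetric_reach_induct)
      case (backward a)
      then obtain b where b: "b \<in> arcs S" "head S b = head S a" "s \<rightarrow>\<^sup>*\<^bsub>S\<^esub> tail S b"
        using reach_last_arc[OF wf, of s "head S a"] s(2) by blast
      then have "b = a" using same backward arcs by blast
      then show ?case using b(3) by simp
    qed (use wf s(1) in \<open>auto intro: reach_arc_trans wf_digraph.reachable_refl\<close>)
  qed
  then show ?thesis using that s(1) by blast
qed

text \<open>
  Replaces undirected connectedness by directed walks from a root, to which induction along arcs
  applies.
\<close>

lemma subtrees_iff:
  assumes X: "rooted_tree X"
  shows "S \<in> subtrees X \<longleftrightarrow> (\<exists>s. rooted_subgraph (graph_of X) S s)"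
proof
  interpret arborescence "graph_of X" "root_of X" using X by (simp add: rooted_tree_iff)
  assume S: "S \<in> subtrees X"
  then obtain s where "s \<in> verts S" "\<And>v. v \<in> verts S \<Longrightarrow> s \<rightarrow>\<^sup>*\<^bsub>S\<^esub> v"
    using connected_subgraph_rooted by (auto simp: subtrees_def)
  then show "\<exists>s. rooted_subgraph (graph_of X) S s"
    using S by (auto simp: subtrees_def rooted_subgraph_def)
next
  assume "\<exists>s. rooted_subgraph (graph_of X) S s"
  then obtain s where S: "rooted_subgraph (graph_of X) S s" by blast
  interpret S: wf_digraph S using rooted_subgraph_imp(1)[OF S] .
  interpret M: pair_wf_digraph "mk_symmetric S" by (rule S.wellformed_mk_symmetric)
  have "connected S"
    unfolding connected_def strongly_connected_def
  proof (intro conjI ballI)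
    fix u v assume "u \<in> verts (with_proj (mk_symmetric S))" "v \<in> verts (with_proj (mk_symmetric S))"
    then have "s \<rightarrow>\<^sup>*\<^bsub>S\<^esub> u" "s \<rightarrow>\<^sup>*\<^bsub>S\<^esub> v" using S by (auto simp: rooted_subgraph_def)
    then show "u \<rightarrow>\<^sup>*\<^bsub>with_proj (mk_symmetric S)\<^esub> v"
      using reach_imp_mk_symmetric[OF S.wf_digraph_axioms] M.reachable_trans by blast
  qed (use S in \<open>auto simp: rooted_subgraph_def\<close>)
  then show "S \<in> subtrees X" using S by (auto simp: subtrees_def rooted_subgraph_def)
qed

lemma closest_rooted_subgraph:
  assumes X: "rooted_tree X" and S: "rooted_subgraph (graph_of X) S s"
  shows "closest X (verts S) = s"
  using S by (intro closest_eqI[OF X])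
    (auto simp: rooted_subgraph_def intro: pre_digraph.reachable_mono)

definition collapse :: "('a, 'b) pre_digraph \<Rightarrow> 'a \<Rightarrow> 'a \<Rightarrow> 'a" where
  "collapse S s v = (if v \<in> verts S then s else v)"

definition quotient_graph ::
    "('a, 'b) pre_digraph \<Rightarrow> ('a, 'b) pre_digraph \<Rightarrow> 'a \<Rightarrow> ('a, 'b) pre_digraph" where
  "quotient_graph G S s = \<lparr> verts = collapse S s ` verts G, arcs = arcs G - arcs S,
     tail = collapse S s \<circ> tail G, head = collapse S s \<circ> head G \<rparr>"

lemma quotient_graph_simps [simp]:
  "verts (quotient_graph G S s) = collapse S s ` verts G"
  "arcs (quotient_graph G S s) = arcs G - arcs S"
  "tail (quotient_graph G S s) a = collapse S s (tail G a)"
  "head (quotient_graph G S s) a = collapse S s (head G a)"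
  by (simp_all add: quotient_graph_def)

lemma contract_eq:
  assumes X: "rooted_tree X" and S: "rooted_subgraph (graph_of X) S s"
  shows "contract X S =
    \<lparr> graph_of = quotient_graph (graph_of X) S s, root_of = collapse S s (root_of X) \<rparr>"
proof -
  have "contract_vert X S = collapse S s"
    by (simp add: fun_eq_iff contract_vert_def collapse_def closest_rooted_subgraph[OF X S])
  then show ?thesis by (simp add: contract_def quotient_graph_def)
qed

locale contraction = arborescence G r
  for G :: "('a, 'b) pre_digraph" and r +
  fixes S :: "('a, 'b) pre_digraph" and s :: 'a
  assumes S: "rooted_subgraph G S s"
begin

abbreviation "Q \<equiv> quotient_graph G S s"

lemmas sub = rooted_subgraph_imp[OF S]

lemma reach_in_S: "v \<in> verts S \<Longrightarrow> s \<rightarrow>\<^sup>*\<^bsub>S\<^esub> v"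
  using S by (simp add: rooted_subgraph_def)

lemma s_in_S: "s \<in> verts S"
  using S by (simp add: rooted_subgraph_def)

lemma collapse_verts: "v \<in> verts G \<Longrightarrow> collapse S s v \<in> verts G"
  using s_in_S sub by (auto simp: collapse_def)

text \<open>
  Every vertex of the subtree other than its root is already entered by an arc of the subtree, so an
  arc that survives the contraction can enter the subtree only at the root.
\<close>

lemma collapse_head:
  assumes "a \<in> arcs G" "a \<notin> arcs S"
  shows "collapse S s (head G a) = head G a"
proof -
  have "head G a = s" if hS: "head G a \<in> verts S"
  proof (rule ccontr)
    assume "head G a \<noteq> s"
    then obtain b where b: "b \<in> arcs S" "head S b = head G a"
      using reach_last_arc[OF sub(1) reach_in_S[OF hS]] by blast
    then have "b = a" using assms(1) sub(3,5) inj_head by (auto dest: inj_onD)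
    then show False using b(1) assms(2) by simp
  qed
  then show ?thesis by (simp add: collapse_def)
qed

lemma collapse_root: "collapse S s r = r"
proof -
  have "s = r" if "r \<in> verts S"
    using reach_root[of s] reachable_mono[OF reach_in_S[OF that]] S
    by (simp add: rooted_subgraph_def)
  then show ?thesis by (simp add: collapse_def)
qed

lemma wf_quotient: "wf_digraph Q"
  by unfold_locales auto

lemma reach_quotient:
  assumes "u \<rightarrow>\<^sup>*\<^bsub>G\<^esub> v" shows "collapse S s u \<rightarrow>\<^sup>*\<^bsub>Q\<^esub> collapse S s v"
  using wf_digraph_axioms assms
proof (induct rule: reach_arc_induct)
  case base
  have "u \<in> verts G" using assms by (meson reachable_in_verts)
  then show ?case by (intro wf_digraph.reachable_refl[OF wf_quotient]) simp
next
  case (arc a)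
  show ?case
  proof (cases "a \<in> arcs S")
    case True
    then have "collapse S s (tail G a) = s" "collapse S s (head G a) = s"
      using sub wf_digraph.tail_in_verts[OF sub(1) True] wf_digraph.head_in_verts[OF sub(1) True]
      by (simp_all add: collapse_def)
    then show ?thesis using arc by simp
  next
    case False
    then show ?thesis using reach_arc_trans[OF wf_quotient, of _ a] arc by simp
  qed
qed

lemma arborescence_quotient: "arborescence Q r"
proof -
  interpret Q: wf_digraph Q by (rule wf_quotient)
  show ?thesis
  proof
    fix v assume "v \<in> verts Q"
    then show "r \<rightarrow>\<^sup>*\<^bsub>Q\<^esub> v" using reach_quotient[OF root_reaches] by (auto simp: collapse_root)
  next
    show "r \<in> verts Q" using root_in_verts collapse_root by (metis image_eqI quotient_graph_simps(1))
  next
    show "inj_on (head Q) (arcs Q)"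
      using inj_head by (auto simp: inj_on_def collapse_head)
  qed (auto simp: collapse_head head_neq_root)
qed

text \<open>
  The arcs of the subtree lead from its root to all its vertices, and none of them crosses the cut.
\<close>

lemma subtree_one_side:
  assumes "c \<in> arcs G" "c \<notin> arcs S" "v \<in> verts S"
  shows "v \<in> descendants G (head G c) \<longleftrightarrow> s \<in> descendants G (head G c)"
  using sub(1) reach_in_S[OF assms(3)]
proof (induct rule: reach_arc_induct)
  case (arc a)
  then show ?case using descendants_arc_iff[OF assms(1), of a] assms(2) sub by auto
qed simp

lemma collapse_descendants_iff:
  assumes "c \<in> arcs G" "c \<notin> arcs S"
  shows "collapse S s v \<in> descendants G (head G c) \<longleftrightarrow> v \<in> descendants G (head G c)"
  using subtree_one_side[OF assms] by (auto simp: collapse_def)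

text \<open>
  A walk in the quotient may leave the contracted vertex from any vertex of the subtree.  This does
  not reach new descendants, because the subtree lies on one side of the cut.
\<close>

lemma descendants_quotient:
  assumes c: "c \<in> arcs G" "c \<notin> arcs S"
  shows "descendants Q (head Q c) = collapse S s ` descendants G (head G c)" (is "_ = _ ` ?D")
proof (intro equalityI subsetI)
  fix v assume "v \<in> descendants Q (head Q c)"
  then have "head Q c \<rightarrow>\<^sup>*\<^bsub>Q\<^esub> v" by (simp add: descendants_def)
  with wf_quotient show "v \<in> collapse S s ` ?D"
  proof (induct rule: reach_arc_induct)
    case base
    then show ?case using head_in_descendants[OF c(1)] by auto
  next
    case (arc a)
    then have a: "a \<in> arcs G" "a \<notin> arcs S" by auto
    obtain x where "collapse S s (tail G a) = collapse S s x" "x \<in> ?D" using arc(3) by auto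
    then have "tail G a \<in> ?D" using collapse_descendants_iff[OF c] by metis
    then have "head G a \<in> ?D"
      using reach_arc_trans[OF wf_digraph_axioms _ a(1)] by (simp add: descendants_def)
    then show ?case by simp
  qed
next
  fix v assume "v \<in> collapse S s ` ?D"
  then show "v \<in> descendants Q (head Q c)"
    using reach_quotient by (auto simp: descendants_def)
qed

end

text \<open>
  The condition on \<open>W\<close> says that it does not split the subtree; this is what makes the ends of an arc
  lie in \<open>W\<close> exactly when the ends of the contracted arc lie in its image.
\<close>

lemma quotient_graph_restrict:
  assumes "\<And>v. v \<in> verts G \<Longrightarrow> collapse S s v \<in> collapse S s ` W \<longleftrightarrow> v \<in> W"
    "wf_digraph G"
  shows "quotient_graph (pre_digraph.del_arc G c \<restriction> W) S s =
    pre_digraph.del_arc (quotient_graph G S s) c \<restriction> (collapse S s ` W)"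
proof -
  interpret wf_digraph G by fact
  have "tail G a \<in> W \<longleftrightarrow> collapse S s (tail G a) \<in> collapse S s ` W"
    "head G a \<in> W \<longleftrightarrow> collapse S s (head G a) \<in> collapse S s ` W" if "a \<in> arcs G" for a
    using assms(1)[of "tail G a"] assms(1)[of "head G a"] that by simp_all
  then have "{a \<in> arcs G - {c}. tail G a \<in> W \<and> head G a \<in> W} - arcs S =
    {a \<in> arcs G - arcs S - {c}. collapse S s (tail G a) \<in> collapse S s ` W \<and>
       collapse S s (head G a) \<in> collapse S s ` W}"
    by blast
  then show ?thesis
    by (simp add: quotient_graph_def pre_digraph.del_arc_def induce_subgraph_def)
qed

text \<open>
  A subgraph keeps the \<^const>\<open>tail\<close> and \<^const>\<open>head\<close> functions of its host, and so do the parts of a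
  cut; hence a subtree of a part is literally a subtree of the whole tree.
\<close>

lemma rooted_subgraph_restrict_iff:
  assumes "wf_digraph G" "W \<subseteq> verts G"
  shows "rooted_subgraph (pre_digraph.del_arc G c \<restriction> W) S s \<longleftrightarrow>
    rooted_subgraph G S s \<and> verts S \<subseteq> W \<and> c \<notin> arcs S"
proof -
  interpret wf_digraph G by fact
  have wf: "wf_digraph (del_arc c \<restriction> W)" by (auto simp: wf_digraph_def)
  have "subgraph S (del_arc c \<restriction> W) \<longleftrightarrow> subgraph S G \<and> verts S \<subseteq> W \<and> c \<notin> arcs S"
  proof -
    have "tail S a \<in> verts S \<and> head S a \<in> verts S" if "wf_digraph S" "a \<in> arcs S" for a
      using that by (simp add: wf_digraph_def)
    then show ?thesis using wf wf_digraph_axioms assms(2)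
      unfolding subgraph_def compatible_def
      by (auto simp: subset_iff)
  qed
  then show ?thesis by (auto simp: rooted_subgraph_def)
qed

lemma contraction_of_tree:
  "rooted_tree X \<Longrightarrow> rooted_subgraph (graph_of X) S s \<Longrightarrow> contraction (graph_of X) (root_of X) S s"
  by (simp add: contraction_def contraction_axioms_def rooted_tree_iff)

lemma rooted_tree_contract:
  assumes X: "rooted_tree X" and S: "S \<in> subtrees X"
  shows "rooted_tree (contract X S)"
proof -
  obtain s where S: "rooted_subgraph (graph_of X) S s" using S subtrees_iff[OF X] by blast
  interpret contraction "graph_of X" "root_of X" S s using contraction_of_tree[OF X S] .
  show ?thesis
    using arborescence_quotient by (simp add: rooted_tree_iff contract_eq[OF X S] collapse_root)
qed

lemma rooted_tree_root_subtree:
  assumes X: "rooted_tree X" and mem: "S \<in> subtrees X"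
  shows "rooted_tree (root_subtree X S)"
proof -
  obtain s where s: "rooted_subgraph (graph_of X) S s" using mem subtrees_iff[OF X] by blast
  interpret contraction "graph_of X" "root_of X" S s using contraction_of_tree[OF X s] .
  interpret S: wf_digraph S by (rule sub(1))
  have neq: "head S a \<noteq> s" if a: "a \<in> arcs S" for a
  proof
    assume "head S a = s"
    then have "head (graph_of X) a \<rightarrow>\<^sup>*\<^bsub>graph_of X\<^esub> tail (graph_of X) a"
      using reachable_mono[OF reach_in_S[OF S.tail_in_verts[OF a]]] s sub
      by (simp add: rooted_subgraph_def)
    then show False using head_not_reach_tail a sub(3) by blast
  qed
  have "inj_on (head S) (arcs S)" using inj_head sub by (auto intro: inj_on_subset)
  then have "arborescence S s"
    using neq reach_in_S s_in_S finite_subset[OF sub(2)] finite_subset[OF sub(3)]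
    by unfold_locales auto
  then show ?thesis
    by (simp add: rooted_tree_iff root_subtree_def closest_rooted_subgraph[OF X s])
qed

text \<open>
  \<^const>\<open>tail\<close> and \<^const>\<open>head\<close> are total functions, so graphs that coincide in every relevant way
  may still differ as records off their arcs.
\<close>

lemma rooted_iso_agree:
  assumes "wf_digraph (graph_of X)" "rverts X = rverts Y" "rarcs X = rarcs Y" "root_of X = root_of Y"
    "\<And>a. a \<in> rarcs X \<Longrightarrow> tail (graph_of X) a = tail (graph_of Y) a"
    "\<And>a. a \<in> rarcs X \<Longrightarrow> head (graph_of X) a = head (graph_of Y) a"
  shows "rooted_iso X Y"
  unfolding rooted_iso_def
  by (intro exI[of _ "\<lparr> iso_verts = id, iso_arcs = id,
        iso_head = head (graph_of Y), iso_tail = tail (graph_of Y) \<rparr>"])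
     (use assms in \<open>auto simp: pre_digraph.digraph_isomorphism_def app_iso_def\<close>)

section \<open>Cutting and contracting\<close>

text \<open>
  Cutting after contracting is contracting both parts of the cut, whichever part contains the subtree;
  in the other part the contraction is trivial.
\<close>

lemma cut_of_contract:
  assumes X: "rooted_tree X" and S: "rooted_subgraph (graph_of X) S s"
    and c: "c \<in> rarcs X" "c \<notin> arcs S"
  shows "branch (contract X S) c =
      \<lparr> graph_of = quotient_graph (graph_of (branch X c)) S s, root_of = head (graph_of X) c \<rparr>"
    and "trunk (contract X S) c =
      \<lparr> graph_of = quotient_graph (graph_of (trunk X c)) S s, root_of = root_of X \<rparr>"
proof -
  interpret contraction "graph_of X" "root_of X" S s using contraction_of_tree[OF X S] .
  let ?D = "descendants (graph_of X) (head (graph_of X) c)"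
  let ?T = "rverts X - ?D"
  have con: "contract X S = \<lparr> graph_of = Q, root_of = root_of X \<rparr>"
    using contract_eq[OF X S] by (simp add: collapse_root)
  have tree: "rooted_tree (contract X S)"
    using rooted_tree_contract[OF X] S subtrees_iff[OF X] by blast
  have cQ: "c \<in> rarcs (contract X S)" using c by (simp add: con)
  have same: "v \<in> ?D \<longleftrightarrow> w \<in> ?D" if "collapse S s v = collapse S s w" for v w
    using collapse_descendants_iff[OF c, of v] collapse_descendants_iff[OF c, of w] that by simp
  have D: "collapse S s v \<in> collapse S s ` ?D \<longleftrightarrow> v \<in> ?D" for v
    using same by blast
  have T: "collapse S s v \<in> collapse S s ` ?T \<longleftrightarrow> v \<in> ?T" if "v \<in> rverts X" for v
    using same that by blast
  have desc: "descendants Q (collapse S s (head (graph_of X) c)) = collapse S s ` ?D"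
    using descendants_quotient[OF c] by simp
  have "verts Q - collapse S s ` ?D = collapse S s ` ?T"
    using D T by auto
  then show "trunk (contract X S) c =
      \<lparr> graph_of = quotient_graph (graph_of (trunk X c)) S s, root_of = root_of X \<rparr>"
    unfolding trunk_eq[OF tree cQ] trunk_eq[OF X c(1)]
    using quotient_graph_restrict[OF T wf_digraph_axioms] desc by (simp add: con)
  show "branch (contract X S) c =
      \<lparr> graph_of = quotient_graph (graph_of (branch X c)) S s, root_of = head (graph_of X) c \<rparr>"
    unfolding branch_eq[OF tree cQ] branch_eq[OF X c(1)]
    using quotient_graph_restrict[OF D wf_digraph_axioms] desc
    by (simp add: con collapse_head[OF c])
qed

lemma rooted_subgraph_branch_iff:
  assumes X: "rooted_tree X" and c: "c \<in> rarcs X"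
  shows "rooted_subgraph (graph_of (branch X c)) S s \<longleftrightarrow>
    rooted_subgraph (graph_of X) S s \<and>
    verts S \<subseteq> descendants (graph_of X) (head (graph_of X) c) \<and> c \<notin> arcs S"
proof -
  interpret arborescence "graph_of X" "root_of X" using X by (simp add: rooted_tree_iff)
  show ?thesis
    using rooted_subgraph_restrict_iff[OF wf_digraph_axioms descendants_subset]
    by (simp add: branch_eq[OF X c])
qed

lemma rooted_subgraph_trunk_iff:
  assumes X: "rooted_tree X" and c: "c \<in> rarcs X"
  shows "rooted_subgraph (graph_of (trunk X c)) S s \<longleftrightarrow>
    rooted_subgraph (graph_of X) S s \<and>
    verts S \<subseteq> rverts X - descendants (graph_of X) (head (graph_of X) c) \<and> c \<notin> arcs S"
proof -
  interpret arborescence "graph_of X" "root_of X" using X by (simp add: rooted_tree_iff)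
  show ?thesis
    using rooted_subgraph_restrict_iff[OF wf_digraph_axioms, of "rverts X - _"]
    by (simp add: trunk_eq[OF X c])
qed

text \<open>
  Contracting elsewhere leaves a part of the cut unchanged except for the endpoint functions off
  its arcs.
\<close>

lemma rooted_iso_quotient_disjoint:
  assumes Y: "rooted_tree Y" and S: "wf_digraph S" "tail S = tail (graph_of Y)"
    and disj: "verts S \<inter> rverts Y = {}"
  shows "rooted_iso Y \<lparr> graph_of = quotient_graph (graph_of Y) S s, root_of = root_of Y \<rparr>"
proof -
  interpret arborescence "graph_of Y" "root_of Y" using Y by (simp add: rooted_tree_iff)
  have id: "collapse S s v = v" if "v \<in> rverts Y" for v
    using disj that by (auto simp: collapse_def)
  have "a \<notin> arcs S" if "a \<in> rarcs Y" for a
    using wf_digraph.tail_in_verts[OF S(1)] tail_in_verts[OF that] S(2) disj by auto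
  then have "rarcs Y - arcs S = rarcs Y" by auto
  then show ?thesis
    by (intro rooted_iso_agree) (simp_all add: id wf_digraph_axioms)
qed

lemma subtree_of_part:
  assumes X: "rooted_tree X" and c: "c \<in> rarcs X"
    and S: "S \<in> subtrees (branch X c) \<or> S \<in> subtrees (trunk X c)"
  shows "S \<in> subtrees X" "c \<notin> arcs S"
  using S rooted_subgraph_branch_iff[OF X c] rooted_subgraph_trunk_iff[OF X c]
  by (auto simp: subtrees_iff X rooted_tree_branch[OF X c] rooted_tree_trunk[OF X c])

text \<open>
  The contracted vertex is named after the root of \<open>S\<close>, and this root is the same whether depths are
  measured in the branch or in the whole tree; hence the first two statements are equalities, not
  only isomorphisms.  In the trunk the two graphs agree only on their arcs.
\<close>

lemma subtree_of_branch:
  assumes X: "rooted_tree X" and c: "c \<in> rarcs X" and S: "S \<in> subtrees (branch X c)"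
  shows "root_subtree (branch X c) S = root_subtree X S"
    and "branch (contract X S) c = contract (branch X c) S"
    and "rooted_iso (trunk X c) (trunk (contract X S) c)"
proof -
  note B = rooted_tree_branch[OF X c]
  obtain s where SB: "rooted_subgraph (graph_of (branch X c)) S s"
    using S subtrees_iff[OF B] by blast
  then have SX: "rooted_subgraph (graph_of X) S s" and cS: "c \<notin> arcs S"
    and SD: "verts S \<subseteq> descendants (graph_of X) (head (graph_of X) c)"
    using rooted_subgraph_branch_iff[OF X c] by auto
  interpret contraction "graph_of X" "root_of X" S s using contraction_of_tree[OF X SX] .
  show "root_subtree (branch X c) S = root_subtree X S"
    by (simp add: root_subtree_def closest_rooted_subgraph[OF X SX] closest_rooted_subgraph[OF B SB])
  show "branch (contract X S) c = contract (branch X c) S"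
    using collapse_head[OF c cS]
    unfolding cut_of_contract[OF X SX c cS] contract_eq[OF B SB] by (simp add: branch_eq[OF X c])
  have "rooted_iso (trunk X c)
    \<lparr> graph_of = quotient_graph (graph_of (trunk X c)) S s, root_of = root_of (trunk X c) \<rparr>"
    by (rule rooted_iso_quotient_disjoint[OF rooted_tree_trunk[OF X c]])
       (use sub SD in \<open>auto simp: trunk_eq[OF X c]\<close>)
  moreover have "root_of (trunk X c) = root_of X" by (simp add: trunk_def Let_def)
  ultimately show "rooted_iso (trunk X c) (trunk (contract X S) c)"
    unfolding cut_of_contract(2)[OF X SX c cS] by simp
qed

lemma subtree_of_trunk:
  assumes X: "rooted_tree X" and c: "c \<in> rarcs X" and S: "S \<in> subtrees (trunk X c)"
  shows "root_subtree (trunk X c) S = root_subtree X S"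
    and "trunk (contract X S) c = contract (trunk X c) S"
    and "rooted_iso (branch X c) (branch (contract X S) c)"
proof -
  note T = rooted_tree_trunk[OF X c]
  obtain s where ST: "rooted_subgraph (graph_of (trunk X c)) S s"
    using S subtrees_iff[OF T] by blast
  then have SX: "rooted_subgraph (graph_of X) S s" and cS: "c \<notin> arcs S"
    and SD: "verts S \<subseteq> rverts X - descendants (graph_of X) (head (graph_of X) c)"
    using rooted_subgraph_trunk_iff[OF X c] by auto
  interpret contraction "graph_of X" "root_of X" S s using contraction_of_tree[OF X SX] .
  show "root_subtree (trunk X c) S = root_subtree X S"
    by (simp add: root_subtree_def closest_rooted_subgraph[OF X SX] closest_rooted_subgraph[OF T ST])
  show "trunk (contract X S) c = contract (trunk X c) S"
    using collapse_root
    unfolding cut_of_contract[OF X SX c cS] contract_eq[OF T ST] by (simp add: trunk_eq[OF X c])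
  have "rooted_iso (branch X c)
    \<lparr> graph_of = quotient_graph (graph_of (branch X c)) S s, root_of = root_of (branch X c) \<rparr>"
    by (rule rooted_iso_quotient_disjoint[OF rooted_tree_branch[OF X c]])
       (use sub SD in \<open>auto simp: branch_eq[OF X c]\<close>)
  moreover have "root_of (branch X c) = head (graph_of X) c" by (simp add: branch_eq[OF X c])
  ultimately show "rooted_iso (branch X c) (branch (contract X S) c)"
    unfolding cut_of_contract(1)[OF X SX c cS] by simp
qed

lemma subtree_in_one_part:
  assumes X: "rooted_tree X" and c: "c \<in> rarcs X" and mem: "S \<in> subtrees X" and cS: "c \<notin> arcs S"
  shows "S \<in> subtrees (branch X c) \<longleftrightarrow> S \<notin> subtrees (trunk X c)"
proof -
  obtain s where SX: "rooted_subgraph (graph_of X) S s" using mem subtrees_iff[OF X] by blast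
  interpret contraction "graph_of X" "root_of X" S s using contraction_of_tree[OF X SX] .
  let ?D = "descendants (graph_of X) (head (graph_of X) c)"
  have B: "S \<in> subtrees (branch X c) \<longleftrightarrow> verts S \<subseteq> ?D"
    using SX cS rooted_subgraph_branch_iff[OF X c] subtrees_iff[OF rooted_tree_branch[OF X c]]
    by auto
  have T: "S \<in> subtrees (trunk X c) \<longleftrightarrow> verts S \<subseteq> rverts X - ?D"
    using SX cS rooted_subgraph_trunk_iff[OF X c] subtrees_iff[OF rooted_tree_trunk[OF X c]]
    by auto
  show ?thesis
    using subtree_one_side[OF c cS] s_in_S sub(2) unfolding B T by blast
qed

section \<open>Invariance under isomorphism\<close>

lemma rooted_isoI:
  assumes "wf_digraph (graph_of X)"
    and "bij_betw fv (rverts X) (rverts Y)" "bij_betw fa (rarcs X) (rarcs Y)"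
    and "\<And>a. a \<in> rarcs X \<Longrightarrow> tail (graph_of Y) (fa a) = fv (tail (graph_of X) a)"
    and "\<And>a. a \<in> rarcs X \<Longrightarrow> head (graph_of Y) (fa a) = fv (head (graph_of X) a)"
    and "root_of Y = fv (root_of X)"
  shows "rooted_iso X Y"
  unfolding rooted_iso_def
  by (intro exI[of _ "\<lparr> iso_verts = fv, iso_arcs = fa,
        iso_head = head (graph_of Y), iso_tail = tail (graph_of Y) \<rparr>"])
     (use assms in \<open>auto simp: pre_digraph.digraph_isomorphism_def app_iso_def bij_betw_def\<close>)

locale tree_iso = G: arborescence G r + H: arborescence H q
  for G :: "('a, 'b) pre_digraph" and r and H :: "('c, 'd) pre_digraph" and q +
  fixes fv :: "'a \<Rightarrow> 'c" and fa :: "'b \<Rightarrow> 'd"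
  assumes bij_verts: "bij_betw fv (verts G) (verts H)"
    and bij_arcs: "bij_betw fa (arcs G) (arcs H)"
    and tail_iso: "\<And>a. a \<in> arcs G \<Longrightarrow> tail H (fa a) = fv (tail G a)"
    and head_iso: "\<And>a. a \<in> arcs G \<Longrightarrow> head H (fa a) = fv (head G a)"
    and root_iso: "q = fv r"

lemma rooted_iso_tree_iso:
  assumes X: "rooted_tree X" and iso: "rooted_iso X Y"
  obtains fv fa where "tree_iso (graph_of X) (root_of X) (graph_of Y) (root_of Y) fv fa"
proof -
  obtain f where f: "pre_digraph.digraph_isomorphism (graph_of X) f"
    "graph_of Y = app_iso f (graph_of X)" "root_of Y = iso_verts f (root_of X)"
    using iso by (auto simp: rooted_iso_def)
  have "tree_iso (graph_of X) (root_of X) (graph_of Y) (root_of Y) (iso_verts f) (iso_arcs f)"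
    using X rooted_tree_iso[OF X iso] f
    by (auto simp: tree_iso_def tree_iso_axioms_def rooted_tree_iff bij_betw_def
        pre_digraph.digraph_isomorphism_def)
  then show ?thesis using that by blast
qed

context tree_iso begin

lemma fv_verts: "v \<in> verts G \<Longrightarrow> fv v \<in> verts H"
  using bij_verts by (auto simp: bij_betw_def)

lemma fa_arcs: "a \<in> arcs G \<Longrightarrow> fa a \<in> arcs H"
  using bij_arcs by (auto simp: bij_betw_def)

lemma fv_eq_iff: "u \<in> verts G \<Longrightarrow> v \<in> verts G \<Longrightarrow> fv u = fv v \<longleftrightarrow> u = v"
  using bij_verts by (auto simp: bij_betw_def dest: inj_onD)

lemma fa_eq_iff: "a \<in> arcs G \<Longrightarrow> b \<in> arcs G \<Longrightarrow> fa a = fa b \<longleftrightarrow> a = b"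
  using bij_arcs by (auto simp: bij_betw_def dest: inj_onD)

lemma reach_iso:
  assumes "u \<rightarrow>\<^sup>*\<^bsub>G\<^esub> v" shows "fv u \<rightarrow>\<^sup>*\<^bsub>H\<^esub> fv v"
  using G.wf_digraph_axioms assms
proof (induct rule: reach_arc_induct)
  case base
  have "u \<in> verts G" using assms by (meson G.reachable_in_verts)
  then show ?case using fv_verts by auto
next
  case (arc a)
  then show ?case
    using reach_arc_trans[OF H.wf_digraph_axioms, of "fv u" "fa a"] fa_arcs tail_iso head_iso by simp
qed

lemma reach_iso_imp:
  assumes "fv u \<rightarrow>\<^sup>*\<^bsub>H\<^esub> w" "u \<in> verts G" "v \<in> verts G" "w = fv v"
  shows "u \<rightarrow>\<^sup>*\<^bsub>G\<^esub> v"
proof -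
  have "\<forall>v \<in> verts G. w = fv v \<longrightarrow> u \<rightarrow>\<^sup>*\<^bsub>G\<^esub> v"
    using H.wf_digraph_axioms assms(1)
  proof (induct rule: reach_arc_induct)
    case base
    then show ?case using assms(2) fv_eq_iff by auto
  next
    case (arc b)
    then obtain a where a: "a \<in> arcs G" "b = fa a" using bij_arcs by (auto simp: bij_betw_def)
    then have "u \<rightarrow>\<^sup>*\<^bsub>G\<^esub> tail G a" using arc(3) tail_iso by simp
    then have "u \<rightarrow>\<^sup>*\<^bsub>G\<^esub> head G a" using reach_arc_trans[OF G.wf_digraph_axioms] a(1) by blast
    then show ?case using a head_iso fv_eq_iff by auto
  qed
  then show ?thesis using assms by blast
qed

lemma descendants_iso:
  assumes "u \<in> verts G" shows "descendants H (fv u) = fv ` descendants G u"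
proof (intro equalityI subsetI)
  fix w assume w: "w \<in> descendants H (fv u)"
  then have "w \<in> verts H" using H.descendants_subset by blast
  then obtain v where v: "v \<in> verts G" "w = fv v" using bij_verts by (auto simp: bij_betw_def)
  then have "v \<in> descendants G u"
    using reach_iso_imp[OF _ assms v(1)] w by (simp add: descendants_def)
  then show "w \<in> fv ` descendants G u" using v by blast
qed (auto simp: descendants_def reach_iso)

lemma restrict_iso:
  assumes c: "c \<in> arcs G" and W: "W \<subseteq> verts G" and p: "p \<in> W"
  shows "rooted_iso \<lparr> graph_of = G.del_arc c \<restriction> W, root_of = p \<rparr>
    \<lparr> graph_of = H.del_arc (fa c) \<restriction> (fv ` W), root_of = fv p \<rparr>"
proof -
  have mem: "fv v \<in> fv ` W \<longleftrightarrow> v \<in> W" if "v \<in> verts G" for v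
    using that W fv_eq_iff by (auto simp: subset_iff)
  have "bij_betw fv W (fv ` W)"
    using bij_verts W by (auto simp: bij_betw_def intro: inj_on_subset)
  moreover have "bij_betw fa {a \<in> arcs G - {c}. tail G a \<in> W \<and> head G a \<in> W}
      {b \<in> arcs H - {fa c}. tail H b \<in> fv ` W \<and> head H b \<in> fv ` W}" (is "bij_betw fa ?A ?B")
  proof -
    have "inj_on fa ?A" using bij_arcs by (auto simp: bij_betw_def intro: inj_on_subset)
    moreover have "fa ` ?A \<subseteq> ?B"
      using fa_arcs fa_eq_iff c tail_iso head_iso by auto
    moreover have "?B \<subseteq> fa ` ?A"
    proof
      fix b assume b: "b \<in> ?B"
      then obtain a where a: "a \<in> arcs G" "b = fa a" using bij_arcs by (auto simp: bij_betw_def)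
      then have "a \<in> ?A" using b mem tail_iso[OF a(1)] head_iso[OF a(1)] by auto
      then show "b \<in> fa ` ?A" using a(2) by blast
    qed
    ultimately show ?thesis by (auto simp: bij_betw_def)
  qed
  moreover have "wf_digraph (G.del_arc c \<restriction> W)" by (auto simp: wf_digraph_def)
  ultimately show ?thesis
    by (intro rooted_isoI[where fv = fv and fa = fa]) (auto simp: tail_iso head_iso)
qed

text \<open>
  Using the endpoint functions of \<open>H\<close>, not those transported from \<open>S\<close>, makes the image a subgraph
  of \<open>H\<close>.
\<close>

definition image_subgraph :: "('a, 'b) pre_digraph \<Rightarrow> ('c, 'd) pre_digraph" where
  "image_subgraph S = \<lparr> verts = fv ` verts S, arcs = fa ` arcs S, tail = tail H, head = head H \<rparr>"

lemma image_subgraph_simps [simp]: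
  "verts (image_subgraph S) = fv ` verts S" "arcs (image_subgraph S) = fa ` arcs S"
  "tail (image_subgraph S) = tail H" "head (image_subgraph S) = head H"
  by (simp_all add: image_subgraph_def)

lemma rooted_subgraph_image:
  assumes S: "rooted_subgraph G S s"
  shows "rooted_subgraph H (image_subgraph S) (fv s)"
proof -
  note sub = rooted_subgraph_imp[OF S]
  have ends: "tail H (fa a) = fv (tail S a)" "head H (fa a) = fv (head S a)" if "a \<in> arcs S" for a
    using that sub tail_iso head_iso by auto
  have wf: "wf_digraph (image_subgraph S)"
    using ends wf_digraph.tail_in_verts[OF sub(1)] wf_digraph.head_in_verts[OF sub(1)]
    by unfold_locales auto
  have "fv s \<rightarrow>\<^sup>*\<^bsub>image_subgraph S\<^esub> fv v" if "v \<in> verts S" for v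
  proof -
    have "s \<rightarrow>\<^sup>*\<^bsub>S\<^esub> v" using S that by (simp add: rooted_subgraph_def)
    with sub(1) show ?thesis
    proof (induct rule: reach_arc_induct)
      case base
      have "s \<in> verts S" using S by (simp add: rooted_subgraph_def)
      then show ?case by (intro wf_digraph.reachable_refl[OF wf]) simp
    next
      case (arc a)
      then show ?case using reach_arc_trans[OF wf, of "fv s" "fa a"] ends by simp
    qed
  qed
  moreover have "subgraph (image_subgraph S) H"
    using wf sub fv_verts fa_arcs H.wf_digraph_axioms by (auto simp: subgraph_def compatible_def)
  ultimately show ?thesis using S by (auto simp: rooted_subgraph_def)
qed

lemma image_subgraph_iso:
  assumes S: "rooted_subgraph G S s"
  shows "rooted_iso \<lparr> graph_of = S, root_of = s \<rparr> \<lparr> graph_of = image_subgraph S, root_of = fv s \<rparr>"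
proof -
  note sub = rooted_subgraph_imp[OF S]
  have "bij_betw fv (verts S) (fv ` verts S)" "bij_betw fa (arcs S) (fa ` arcs S)"
    using bij_verts bij_arcs sub by (auto simp: bij_betw_def intro: inj_on_subset)
  moreover have "tail H (fa a) = fv (tail S a)" "head H (fa a) = fv (head S a)" if "a \<in> arcs S" for a
    using that sub tail_iso head_iso by auto
  ultimately show ?thesis using sub(1) by (intro rooted_isoI[where fv = fv and fa = fa]) auto
qed

lemma quotient_graph_iso:
  assumes S: "rooted_subgraph G S s"
  shows "rooted_iso \<lparr> graph_of = quotient_graph G S s, root_of = collapse S s r \<rparr>
    \<lparr> graph_of = quotient_graph H (image_subgraph S) (fv s),
      root_of = collapse (image_subgraph S) (fv s) q \<rparr>"
proof -
  interpret contraction G r S s by unfold_locales (rule S)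
  have col: "collapse (image_subgraph S) (fv s) (fv v) = fv (collapse S s v)" if "v \<in> verts G" for v
    using that sub(2) fv_eq_iff by (auto simp: collapse_def subset_iff)
  have "collapse (image_subgraph S) (fv s) ` verts H = fv ` collapse S s ` verts G"
  proof -
    have "verts H = fv ` verts G" using bij_verts by (simp add: bij_betw_def)
    then show ?thesis unfolding image_image using col by (simp add: image_image)
  qed
  moreover have "inj_on fv (collapse S s ` verts G)"
    using bij_verts collapse_verts by (auto simp: bij_betw_def intro: inj_on_subset)
  ultimately have "bij_betw fv (collapse S s ` verts G)
      (collapse (image_subgraph S) (fv s) ` verts H)"
    by (simp add: bij_betw_def)
  moreover have "bij_betw fa (arcs G - arcs S) (arcs H - fa ` arcs S)"
  proof -
    have "fa ` (arcs G - arcs S) = arcs H - fa ` arcs S"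
      using bij_arcs sub(3) inj_on_image_set_diff[of fa "arcs G" "arcs G" "arcs S"]
      by (auto simp: bij_betw_def)
    then show ?thesis using bij_arcs by (auto simp: bij_betw_def intro: inj_on_subset)
  qed
  ultimately show ?thesis
    using wf_quotient col root_iso G.root_in_verts
    by (intro rooted_isoI[where fv = fv and fa = fa]) (auto simp: tail_iso head_iso)
qed

lemma image_subgraph_inj:
  assumes "rooted_subgraph G S s" "rooted_subgraph G S' s'" "image_subgraph S = image_subgraph S'"
  shows "S = S'"
proof -
  note sub = rooted_subgraph_imp[OF assms(1)] and sub' = rooted_subgraph_imp[OF assms(2)]
  have "fv ` verts S = fv ` verts S'" "fa ` arcs S = fa ` arcs S'"
    using assms(3) by (simp_all add: image_subgraph_def)
  then have "verts S = verts S'" "arcs S = arcs S'"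
    using bij_verts bij_arcs sub sub' inj_on_image_eq_iff by (metis bij_betw_def)+
  then show ?thesis using sub(4,5) sub'(4,5) by (intro pre_digraph.equality) auto
qed

end

definition cuts ::
    "('c, 'd) rooted_digraph \<Rightarrow> ('e, 'f) rooted_digraph \<Rightarrow> ('a, 'b) rooted_digraph \<Rightarrow> 'b set" where
  "cuts U V X = {c \<in> rarcs X. rooted_iso (branch X c) U \<and> rooted_iso (trunk X c) V}"

definition insertions ::
    "('c, 'd) rooted_digraph \<Rightarrow> ('e, 'f) rooted_digraph \<Rightarrow> ('a, 'b) rooted_digraph \<Rightarrow>
     ('a, 'b) pre_digraph set" where
  "insertions T U X =
     {S \<in> subtrees X. rooted_iso (root_subtree X S) T \<and> rooted_iso (contract X S) U}"

lemma finite_arcs_tree: "rooted_tree X \<Longrightarrow> finite (rarcs X)"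
  by (simp add: rooted_tree_def fin_digraph.finite_arcs)

lemma finite_subtrees:
  assumes "rooted_tree X" shows "finite (subtrees X)"
proof -
  interpret fin_digraph "graph_of X" using assms by (simp add: rooted_tree_def)
  let ?f = "\<lambda>(V, A). \<lparr> verts = V, arcs = A, tail = tail (graph_of X), head = head (graph_of X) \<rparr>"
  have "subtrees X \<subseteq> ?f ` (Pow (rverts X) \<times> Pow (rarcs X))"
  proof
    fix S assume "S \<in> subtrees X"
    then have "S = ?f (verts S, arcs S)" "(verts S, arcs S) \<in> Pow (rverts X) \<times> Pow (rarcs X)"
      by (auto simp: subtrees_def subgraph_def compatible_def)
    then show "S \<in> ?f ` (Pow (rverts X) \<times> Pow (rarcs X))" by (rule image_eqI)
  qed
  then show ?thesis by (rule finite_subset) simp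
qed

lemma rooted_iso_cong:
  assumes "rooted_tree X" "rooted_iso X Y"
  shows "rooted_iso X Z \<longleftrightarrow> rooted_iso Y Z"
  using rooted_iso_trans[OF assms(2)] rooted_iso_trans[OF rooted_iso_sym[OF assms]] by blast

text \<open>
  An isomorphism maps cuts to cuts injectively; since it can be inverted, an inequality suffices for
  equal numbers, and surjectivity need not be shown.
\<close>

lemma card_cuts_le:
  assumes X: "rooted_tree X" and iso: "rooted_iso X Y"
  shows "card (cuts U V X) \<le> card (cuts U V Y)"
proof -
  have Y: "rooted_tree Y" using rooted_tree_iso[OF X iso] .
  obtain fv fa where "tree_iso (graph_of X) (root_of X) (graph_of Y) (root_of Y) fv fa"
    using rooted_iso_tree_iso[OF X iso] .
  then interpret tree_iso "graph_of X" "root_of X" "graph_of Y" "root_of Y" fv fa .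
  have "fa c \<in> cuts U V Y" if "c \<in> cuts U V X" for c
  proof -
    have c: "c \<in> rarcs X" "rooted_iso (branch X c) U" "rooted_iso (trunk X c) V"
      using that by (auto simp: cuts_def)
    note c' = fa_arcs[OF c(1)]
    let ?D = "descendants (graph_of X) (head (graph_of X) c)"
    have D: "descendants (graph_of Y) (head (graph_of Y) (fa c)) = fv ` ?D"
      using descendants_iso head_iso c(1) by simp
    have "rverts Y - fv ` ?D = fv ` (rverts X - ?D)"
      using bij_verts G.descendants_subset
        inj_on_image_set_diff[of fv "rverts X" "rverts X" ?D] by (auto simp: bij_betw_def)
    then have iso_t: "rooted_iso (trunk X c) (trunk Y (fa c))"
      using restrict_iso[OF c(1), of "rverts X - ?D" "root_of X"] root_iso D
        G.root_in_verts G.root_notin_descendants[OF c(1)]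
      by (simp add: trunk_eq X Y c(1) c')
    have iso_b: "rooted_iso (branch X c) (branch Y (fa c))"
      using restrict_iso[OF c(1) G.descendants_subset G.head_in_descendants[OF c(1)]] D
      by (simp add: branch_eq X Y c(1) c' head_iso)
    show ?thesis
      using c c' rooted_iso_cong[OF rooted_tree_branch[OF X c(1)] iso_b, of U]
        rooted_iso_cong[OF rooted_tree_trunk[OF X c(1)] iso_t, of V]
      by (simp add: cuts_def)
  qed
  moreover have "inj_on fa (cuts U V X)"
    using bij_arcs by (auto simp: bij_betw_def cuts_def intro: inj_on_subset)
  moreover have "finite (cuts U V Y)" using finite_arcs_tree[OF Y] by (simp add: cuts_def)
  ultimately show ?thesis by (intro card_inj_on_le) auto
qed

lemma card_cuts_iso:
  assumes "rooted_tree X" "rooted_iso X Y"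
  shows "card (cuts U V X) = card (cuts U V Y)"
  using card_cuts_le[OF assms] card_cuts_le[OF rooted_tree_iso[OF assms] rooted_iso_sym[OF assms]]
  by (rule order_antisym)

lemma card_insertions_le:
  assumes X: "rooted_tree X" and iso: "rooted_iso X Y"
  shows "card (insertions T U X) \<le> card (insertions T U Y)"
proof -
  have Y: "rooted_tree Y" using rooted_tree_iso[OF X iso] .
  obtain fv fa where "tree_iso (graph_of X) (root_of X) (graph_of Y) (root_of Y) fv fa"
    using rooted_iso_tree_iso[OF X iso] .
  then interpret tree_iso "graph_of X" "root_of X" "graph_of Y" "root_of Y" fv fa .
  have "image_subgraph S \<in> insertions T U Y" if "S \<in> insertions T U X" for S
  proof -
    have S: "S \<in> subtrees X" "rooted_iso (root_subtree X S) T" "rooted_iso (contract X S) U"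
      using that by (auto simp: insertions_def)
    obtain s where s: "rooted_subgraph (graph_of X) S s" using S(1) subtrees_iff[OF X] by blast
    note s' = rooted_subgraph_image[OF s]
    have "rooted_iso (root_subtree X S) (root_subtree Y (image_subgraph S))"
      using image_subgraph_iso[OF s]
      by (simp only: root_subtree_def closest_rooted_subgraph[OF X s] closest_rooted_subgraph[OF Y s'])
    then have "rooted_iso (root_subtree Y (image_subgraph S)) T"
      using S(2) rooted_iso_cong[OF rooted_tree_root_subtree[OF X S(1)]] by blast
    moreover have "rooted_iso (contract X S) (contract Y (image_subgraph S))"
      using quotient_graph_iso[OF s] by (simp only: contract_eq[OF X s] contract_eq[OF Y s'])
    then have "rooted_iso (contract Y (image_subgraph S)) U"
      using S(3) rooted_iso_cong[OF rooted_tree_contract[OF X S(1)]] by blast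
    moreover have "image_subgraph S \<in> subtrees Y" using s' subtrees_iff[OF Y] by blast
    ultimately show ?thesis by (simp add: insertions_def)
  qed
  moreover have "inj_on image_subgraph (insertions T U X)"
  proof (rule inj_onI)
    fix S S' assume SS': "S \<in> insertions T U X" "S' \<in> insertions T U X"
      and eq: "image_subgraph S = image_subgraph S'"
    obtain s s' where "rooted_subgraph (graph_of X) S s" "rooted_subgraph (graph_of X) S' s'"
      using SS' subtrees_iff[OF X] unfolding insertions_def by blast
    then show "S = S'" using image_subgraph_inj eq by blast
  qed
  moreover have "finite (insertions T U Y)" using finite_subtrees[OF Y] by (simp add: insertions_def)
  ultimately show ?thesis by (intro card_inj_on_le) auto
qed

lemma card_insertions_iso:
  assumes "rooted_tree X" "rooted_iso X Y"
  shows "card (insertions T U X) = card (insertions T U Y)"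
  using card_insertions_le[OF assms] card_insertions_le[OF rooted_tree_iso[OF assms] rooted_iso_sym[OF assms]]
  by (rule order_antisym)

section \<open>Counting pairs of a cut and a subtree\<close>

text \<open>
  The combinatorial core, for a fixed tree \<open>X\<close>.  After swapping coordinates the set of pairs on the
  left is the disjoint union of the two sets on the right: an arc \<open>c\<close> of \<open>contract X S\<close> is an arc of
  \<open>X\<close> outside \<open>S\<close>, and \<open>S\<close> lies entirely in the branch or entirely in the trunk of \<open>X\<close> at \<open>c\<close>.
\<close>

lemma contract_cut_pairs:
  assumes X: "rooted_tree X"
  shows "card (SIGMA S:{S \<in> subtrees X. rooted_iso (root_subtree X S) T}. cuts U V (contract X S)) =
    card (SIGMA c:{c \<in> rarcs X. rooted_iso (trunk X c) V}. insertions T U (branch X c)) +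
    card (SIGMA c:{c \<in> rarcs X. rooted_iso (branch X c) U}. insertions T V (trunk X c))"
    (is "card ?L = card ?B + card ?T")
proof -
  have arcs: "c \<in> rarcs (contract X S) \<longleftrightarrow> c \<in> rarcs X \<and> c \<notin> arcs S" for c S
    by (simp add: contract_def)
  have split: "(S, c) \<in> ?L \<longleftrightarrow> (c, S) \<in> ?B \<union> ?T" and excl: "(c, S) \<notin> ?B \<inter> ?T" for S c
  proof -
    have "((S, c) \<in> ?L \<longleftrightarrow> (c, S) \<in> ?B \<union> ?T) \<and> (c, S) \<notin> ?B \<inter> ?T"
    proof (cases "c \<in> rarcs X")
      case c: True
      note outside = subtree_of_part[OF X c]
      consider (branch) "S \<in> subtrees (branch X c)" "S \<notin> subtrees (trunk X c)"
          "S \<in> subtrees X" "c \<notin> arcs S"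
        | (trunk) "S \<in> subtrees (trunk X c)" "S \<notin> subtrees (branch X c)"
          "S \<in> subtrees X" "c \<notin> arcs S"
        | (none) "S \<notin> subtrees (trunk X c)" "S \<notin> subtrees (branch X c)"
          "S \<notin> subtrees X \<or> c \<in> arcs S"
        using outside subtree_in_one_part[OF X c] by blast
      then show ?thesis
      proof cases
        case branch
        note eq = subtree_of_branch[OF X c branch(1)]
        show ?thesis
          using c branch rooted_iso_cong[OF rooted_tree_trunk[OF X c] eq(3), of V]
          by (auto simp: cuts_def insertions_def arcs eq(1,2))
      next
        case trunk
        note eq = subtree_of_trunk[OF X c trunk(1)]
        show ?thesis
          using c trunk rooted_iso_cong[OF rooted_tree_branch[OF X c] eq(3), of U]
          by (auto simp: cuts_def insertions_def arcs eq(1,2))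
      next
        case none
        then show ?thesis by (auto simp: cuts_def insertions_def arcs)
      qed
    qed (auto simp: cuts_def arcs)
    then show "(S, c) \<in> ?L \<longleftrightarrow> (c, S) \<in> ?B \<union> ?T" "(c, S) \<notin> ?B \<inter> ?T" by auto
  qed
  have "card ?L = card (prod.swap ` ?L)" by (simp add: card_image)
  also have "prod.swap ` ?L = ?B \<union> ?T"
  proof (intro equalityI subsetI)
    fix p assume "p \<in> prod.swap ` ?L"
    then show "p \<in> ?B \<union> ?T" using split by force
  next
    fix p assume "p \<in> ?B \<union> ?T"
    then have "(snd p, fst p) \<in> ?L" using split[of "snd p" "fst p"] by (metis prod.collapse)
    then have "prod.swap (snd p, fst p) \<in> prod.swap ` ?L" by (rule imageI)
    then show "p \<in> prod.swap ` ?L" by simp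
  qed
  also have "card (?B \<union> ?T) = card ?B + card ?T"
  proof (rule card_Un_disjoint)
    have fin: "finite {c \<in> rarcs X. P c}" for P using finite_arcs_tree[OF X] by simp
    show "finite ?B" "finite ?T"
      using finite_subtrees[OF rooted_tree_branch[OF X]] finite_subtrees[OF rooted_tree_trunk[OF X]]
      by (intro finite_SigmaI fin; simp add: insertions_def)+
    show "?B \<inter> ?T = {}" using excl by fast
  qed
  finally show ?thesis .
qed

text \<open>
  This replaces a test for isomorphism with a representative by an equation in the quotient type, so
  that a sum over all trees \<open>y\<close> in between can be sorted by the tree that a subtree or cut produces.
\<close>

lemma rooted_iso_rep_iff:
  assumes X: "rooted_tree X"
  shows "rooted_iso X (rep_rtree y) \<longleftrightarrow> abs_rtree X = y"
proof -
  have "rtree_eq X X" using X rooted_iso_refl by (simp add: rtree_eq_def)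
  then have "rtree_eq X (rep_rtree y) \<longleftrightarrow> abs_rtree X = y"
    using Quotient_rel[OF Quotient_rtree, of X "rep_rtree y"] rtree_eq_rep
      Quotient_abs_rep[OF Quotient_rtree, of y] by simp
  then show ?thesis using X rooted_tree_rep by (simp add: rtree_eq_def)
qed

lemma cut_number_abs:
  assumes "rooted_tree X"
  shows "cut_number u v (abs_rtree X) = card (cuts (rep_rtree u) (rep_rtree v) X)"
proof -
  have "rooted_iso X (rep_rtree (abs_rtree X))" using rooted_iso_rep_iff[OF assms] by simp
  then have "card (cuts (rep_rtree u) (rep_rtree v) (rep_rtree (abs_rtree X))) =
      card (cuts (rep_rtree u) (rep_rtree v) X)"
    by (rule card_cuts_iso[OF assms, symmetric])
  then show ?thesis by (simp add: cut_number_def cuts_def)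
qed

lemma subtree_number_abs:
  assumes "rooted_tree X"
  shows "subtree_number t u (abs_rtree X) = card (insertions (rep_rtree t) (rep_rtree u) X)"
proof -
  have "rooted_iso X (rep_rtree (abs_rtree X))" using rooted_iso_rep_iff[OF assms] by simp
  then have "card (insertions (rep_rtree t) (rep_rtree u) (rep_rtree (abs_rtree X))) =
      card (insertions (rep_rtree t) (rep_rtree u) X)"
    by (rule card_insertions_iso[OF assms, symmetric])
  then show ?thesis by (simp add: subtree_number_def insertions_def)
qed

lemma sum_card_fibres:
  fixes g :: "'b \<Rightarrow> nat"
  assumes "finite P" "finite Y" "\<And>y. g y \<noteq> 0 \<Longrightarrow> y \<in> Y"
  shows "(\<Sum>y\<in>Y. card {p \<in> P. q p = y} * g y) = (\<Sum>p\<in>P. g (q p))"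
proof -
  have "card {p \<in> P. q p = y} * g y = (\<Sum>p\<in>P. if q p = y then g y else 0)" for y
    using assms(1) by (simp add: sum.If_cases Int_def)
  then have "(\<Sum>y\<in>Y. card {p \<in> P. q p = y} * g y) = (\<Sum>p\<in>P. \<Sum>y\<in>Y. if q p = y then g y else 0)"
    by (simp add: sum.swap[of _ P])
  also have "\<dots> = (\<Sum>p\<in>P. g (q p))"
    using assms(2,3) by (intro sum.cong refl) (auto simp: sum.delta')
  finally show ?thesis .
qed

text \<open>
  Summing over the intermediate tree \<open>y\<close> counts pairs: each subtree \<open>S\<close> of \<open>x\<close> contributes to the
  single class \<open>y\<close> of the contracted tree, and the cuts of that class are the cuts of the
  contracted tree itself.  The next two lemmas do the same for the branch and the trunk of a cut.
\<close>

lemma sum_subtree_cut: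
  assumes "finite Y" "\<And>y. cut_number u v y \<noteq> 0 \<Longrightarrow> y \<in> Y"
  shows "(\<Sum>y\<in>Y. subtree_number t y x * cut_number u v y) =
    card (SIGMA S:{S \<in> subtrees (rep_rtree x). rooted_iso (root_subtree (rep_rtree x) S) (rep_rtree t)}.
      cuts (rep_rtree u) (rep_rtree v) (contract (rep_rtree x) S))"
    (is "_ = card (Sigma ?P _)")
proof -
  let ?X = "rep_rtree x"
  have X: "rooted_tree ?X" by (rule rooted_tree_rep)
  have con: "rooted_tree (contract ?X S)" if "S \<in> ?P" for S
    using rooted_tree_contract[OF X] that by simp
  have finP: "finite ?P" using finite_subtrees[OF X] by simp
  have "subtree_number t y x = card {S \<in> ?P. abs_rtree (contract ?X S) = y}" for y
    unfolding subtree_number_def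
    by (rule arg_cong[where f = card]) (use con rooted_iso_rep_iff in auto)
  then have "(\<Sum>y\<in>Y. subtree_number t y x * cut_number u v y) =
      (\<Sum>S\<in>?P. cut_number u v (abs_rtree (contract ?X S)))"
    using sum_card_fibres[OF finP assms(1), of "cut_number u v"] assms(2) by simp
  also have "\<dots> = (\<Sum>S\<in>?P. card (cuts (rep_rtree u) (rep_rtree v) (contract ?X S)))"
    using con cut_number_abs by (intro sum.cong refl) simp
  also have "\<dots> = card (SIGMA S:?P. cuts (rep_rtree u) (rep_rtree v) (contract ?X S))"
    using finite_arcs_tree[OF con] by (subst card_SigmaI[OF finP]) (auto simp: cuts_def)
  finally show ?thesis .
qed

lemma sum_cut_subtree_branch:
  assumes "finite Y" "\<And>y. subtree_number t u y \<noteq> 0 \<Longrightarrow> y \<in> Y"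
  shows "(\<Sum>y\<in>Y. cut_number y v x * subtree_number t u y) =
    card (SIGMA c:{c \<in> rarcs (rep_rtree x). rooted_iso (trunk (rep_rtree x) c) (rep_rtree v)}.
      insertions (rep_rtree t) (rep_rtree u) (branch (rep_rtree x) c))"
    (is "_ = card (Sigma ?P _)")
proof -
  let ?X = "rep_rtree x"
  have X: "rooted_tree ?X" by (rule rooted_tree_rep)
  have br: "rooted_tree (branch ?X c)" if "c \<in> ?P" for c
    using rooted_tree_branch[OF X] that by simp
  have finP: "finite ?P" using finite_arcs_tree[OF X] by simp
  have "cut_number y v x = card {c \<in> ?P. abs_rtree (branch ?X c) = y}" for y
    unfolding cut_number_def
    by (rule arg_cong[where f = card]) (use br rooted_iso_rep_iff in auto)
  then have "(\<Sum>y\<in>Y. cut_number y v x * subtree_number t u y) =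
      (\<Sum>c\<in>?P. subtree_number t u (abs_rtree (branch ?X c)))"
    using sum_card_fibres[OF finP assms(1), of "subtree_number t u"] assms(2) by simp
  also have "\<dots> = (\<Sum>c\<in>?P. card (insertions (rep_rtree t) (rep_rtree u) (branch ?X c)))"
    using br subtree_number_abs by (intro sum.cong refl) simp
  also have "\<dots> = card (SIGMA c:?P. insertions (rep_rtree t) (rep_rtree u) (branch ?X c))"
    using finite_subtrees[OF br] by (subst card_SigmaI[OF finP]) (auto simp: insertions_def)
  finally show ?thesis .
qed

lemma sum_cut_subtree_trunk:
  assumes "finite Y" "\<And>y. subtree_number t v y \<noteq> 0 \<Longrightarrow> y \<in> Y"
  shows "(\<Sum>y\<in>Y. cut_number u y x * subtree_number t v y) =
    card (SIGMA c:{c \<in> rarcs (rep_rtree x). rooted_iso (branch (rep_rtree x) c) (rep_rtree u)}.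
      insertions (rep_rtree t) (rep_rtree v) (trunk (rep_rtree x) c))"
    (is "_ = card (Sigma ?P _)")
proof -
  let ?X = "rep_rtree x"
  have X: "rooted_tree ?X" by (rule rooted_tree_rep)
  have tr: "rooted_tree (trunk ?X c)" if "c \<in> ?P" for c
    using rooted_tree_trunk[OF X] that by simp
  have finP: "finite ?P" using finite_arcs_tree[OF X] by simp
  have "cut_number u y x = card {c \<in> ?P. abs_rtree (trunk ?X c) = y}" for y
    unfolding cut_number_def
    by (rule arg_cong[where f = card]) (use tr rooted_iso_rep_iff in auto)
  then have "(\<Sum>y\<in>Y. cut_number u y x * subtree_number t v y) =
      (\<Sum>c\<in>?P. subtree_number t v (abs_rtree (trunk ?X c)))"
    using sum_card_fibres[OF finP assms(1), of "subtree_number t v"] assms(2) by simp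
  also have "\<dots> = (\<Sum>c\<in>?P. card (insertions (rep_rtree t) (rep_rtree v) (trunk ?X c)))"
    using tr subtree_number_abs by (intro sum.cong refl) simp
  also have "\<dots> = card (SIGMA c:?P. insertions (rep_rtree t) (rep_rtree v) (trunk ?X c))"
    using finite_subtrees[OF tr] by (subst card_SigmaI[OF finP]) (auto simp: insertions_def)
  finally show ?thesis .
qed

text \<open>
  The coefficient of \<open>x\<close> in the identity for basis trees \<open>t\<close>, \<open>u\<close>, \<open>v\<close>.
\<close>

lemma structure_constants:
  assumes "finite Y" "\<And>y. cut_number u v y \<noteq> 0 \<Longrightarrow> y \<in> Y"
    "\<And>y. subtree_number t u y \<noteq> 0 \<Longrightarrow> y \<in> Y" "\<And>y. subtree_number t v y \<noteq> 0 \<Longrightarrow> y \<in> Y"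
  shows "(\<Sum>y\<in>Y. subtree_number t y x * cut_number u v y) =
    (\<Sum>y\<in>Y. cut_number y v x * subtree_number t u y) +
    (\<Sum>y\<in>Y. cut_number u y x * subtree_number t v y)"
proof -
  have "(\<Sum>y\<in>Y. subtree_number t y x * cut_number u v y) =
      card (SIGMA S:{S \<in> subtrees (rep_rtree x). rooted_iso (root_subtree (rep_rtree x) S) (rep_rtree t)}.
        cuts (rep_rtree u) (rep_rtree v) (contract (rep_rtree x) S))"
    by (rule sum_subtree_cut) (use assms in auto)
  also have "\<dots> =
      card (SIGMA c:{c \<in> rarcs (rep_rtree x). rooted_iso (trunk (rep_rtree x) c) (rep_rtree v)}.
        insertions (rep_rtree t) (rep_rtree u) (branch (rep_rtree x) c)) +
      card (SIGMA c:{c \<in> rarcs (rep_rtree x). rooted_iso (branch (rep_rtree x) c) (rep_rtree u)}.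
        insertions (rep_rtree t) (rep_rtree v) (trunk (rep_rtree x) c))"
    by (rule contract_cut_pairs[OF rooted_tree_rep])
  also have "\<dots> = (\<Sum>y\<in>Y. cut_number y v x * subtree_number t u y) +
      (\<Sum>y\<in>Y. cut_number u y x * subtree_number t v y)"
    by (intro arg_cong2[where f = "(+)"] sum_cut_subtree_branch[symmetric]
        sum_cut_subtree_trunk[symmetric]) (use assms in auto)
  finally show ?thesis .
qed

section \<open>Extension by bilinearity\<close>

text \<open>
  Allowing index sets larger than the supports lets one set \<open>Y\<close> serve for all products that occur
  as arguments.
\<close>

lemma lookup_bilinear_extension:
  assumes "finite A" "Poly_Mapping.keys u \<subseteq> A" "finite B" "Poly_Mapping.keys v \<subseteq> B"
  shows "Poly_Mapping.lookup (bilinear_extension b u v) x =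
    (\<Sum>a\<in>A. \<Sum>a'\<in>B. Poly_Mapping.lookup u a * Poly_Mapping.lookup v a' *
       Poly_Mapping.lookup (b a a') x)"
proof -
  let ?F = "\<lambda>a a'. Poly_Mapping.lookup u a * Poly_Mapping.lookup v a' * Poly_Mapping.lookup (b a a') x"
  have "Poly_Mapping.lookup (bilinear_extension b u v) x =
      (\<Sum>a\<in>Poly_Mapping.keys u. \<Sum>a'\<in>Poly_Mapping.keys v. ?F a a')"
    by (simp add: bilinear_extension_def lookup_sum)
  also have "\<dots> = (\<Sum>a\<in>A. \<Sum>a'\<in>Poly_Mapping.keys v. ?F a a')"
    using assms(1,2) by (intro sum.mono_neutral_left) (auto simp: in_keys_iff)
  also have "\<dots> = (\<Sum>a\<in>A. \<Sum>a'\<in>B. ?F a a')"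
    using assms(3,4) by (intro sum.cong refl sum.mono_neutral_left) (auto simp: in_keys_iff)
  finally show ?thesis .
qed

lemma lookup_sum_single:
  assumes "finite {x. n x \<noteq> 0}"
  shows "Poly_Mapping.lookup
    (\<Sum>x | n x \<noteq> 0. Poly_Mapping.single x (of_nat (n x) :: 'k::field)) y = of_nat (n y)"
  using assms by (simp add: lookup_sum lookup_single when_def sum.delta')

lemma lookup_graft:
  fixes u v :: "rtree \<Rightarrow>\<^sub>0 'k::field"
  assumes "finite A" "Poly_Mapping.keys u \<subseteq> A" "finite B" "Poly_Mapping.keys v \<subseteq> B"
  shows "Poly_Mapping.lookup (graft u v) x =
    (\<Sum>a\<in>A. \<Sum>b\<in>B. Poly_Mapping.lookup u a * Poly_Mapping.lookup v b * of_nat (cut_number a b x))"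
  unfolding graft_def lookup_bilinear_extension[OF assms] lookup_sum_single[OF finite_cut_support] ..

lemma lookup_insertion:
  fixes u v :: "rtree \<Rightarrow>\<^sub>0 'k::field"
  assumes "finite A" "Poly_Mapping.keys u \<subseteq> A" "finite B" "Poly_Mapping.keys v \<subseteq> B"
  shows "Poly_Mapping.lookup (insertion u v) x =
    (\<Sum>a\<in>A. \<Sum>b\<in>B. Poly_Mapping.lookup u a * Poly_Mapping.lookup v b * of_nat (subtree_number a b x))"
  unfolding insertion_def lookup_bilinear_extension[OF assms]
    lookup_sum_single[OF finite_subtree_support] ..

lemma sum_swap3:
  "(\<Sum>y\<in>Y. \<Sum>a\<in>A. \<Sum>b\<in>B. F y a b) = (\<Sum>a\<in>A. \<Sum>b\<in>B. \<Sum>y\<in>Y. F y a b)"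
proof -
  have "(\<Sum>y\<in>Y. \<Sum>a\<in>A. \<Sum>b\<in>B. F y a b) = (\<Sum>a\<in>A. \<Sum>y\<in>Y. \<Sum>b\<in>B. F y a b)" by (rule sum.swap)
  also have "\<dots> = (\<Sum>a\<in>A. \<Sum>b\<in>B. \<Sum>y\<in>Y. F y a b)" by (intro sum.cong refl sum.swap)
  finally show ?thesis .
qed

theorem mainTheorem1:
  fixes t u v :: "rtree \<Rightarrow>\<^sub>0 'k::field"
  assumes "t \<in> nontrivial_trees"
  shows "insertion t (graft u v) = graft (insertion t u) v + graft u (insertion t v)"
proof (rule poly_mapping_eqI)
  fix x
  let ?l = "Poly_Mapping.lookup :: (rtree \<Rightarrow>\<^sub>0 'k) \<Rightarrow> rtree \<Rightarrow> 'k"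
  let ?A = "Poly_Mapping.keys t" and ?B = "Poly_Mapping.keys u" and ?C = "Poly_Mapping.keys v"
  \<comment> \<open>contains the supports of all three inner products\<close>
  define Y where "Y =
    (\<Union>b\<in>?B. \<Union>c\<in>?C. {y. cut_number b c y \<noteq> 0}) \<union>
    (\<Union>a\<in>?A. \<Union>b\<in>?B. {y. subtree_number a b y \<noteq> 0}) \<union>
    (\<Union>a\<in>?A. \<Union>c\<in>?C. {y. subtree_number a c y \<noteq> 0})"
  have finY: "finite Y"
    unfolding Y_def using finite_cut_support finite_subtree_support by (intro finite_UnI finite_UN_I) auto
  have graft_y: "?l (graft u v) y = (\<Sum>b\<in>?B. \<Sum>c\<in>?C. ?l u b * ?l v c * of_nat (cut_number b c y))" for y
    by (rule lookup_graft) simp_all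
  have ins_u: "?l (insertion t u) y =
      (\<Sum>a\<in>?A. \<Sum>b\<in>?B. ?l t a * ?l u b * of_nat (subtree_number a b y))" for y
    by (rule lookup_insertion) simp_all
  have ins_v: "?l (insertion t v) y =
      (\<Sum>a\<in>?A. \<Sum>c\<in>?C. ?l t a * ?l v c * of_nat (subtree_number a c y))" for y
    by (rule lookup_insertion) simp_all
  have keys: "Poly_Mapping.keys (graft u v) \<subseteq> Y" "Poly_Mapping.keys (insertion t u) \<subseteq> Y"
    "Poly_Mapping.keys (insertion t v) \<subseteq> Y"
  proof -
    have "?l (graft u v) y = 0" "?l (insertion t u) y = 0" "?l (insertion t v) y = 0" if "y \<notin> Y" for y
      using that unfolding graft_y ins_u ins_v by (auto simp: Y_def intro!: sum.neutral)
    then show "Poly_Mapping.keys (graft u v) \<subseteq> Y" "Poly_Mapping.keys (insertion t u) \<subseteq> Y"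
      "Poly_Mapping.keys (insertion t v) \<subseteq> Y"
      by (auto simp: in_keys_iff)
  qed
  let ?k = "\<lambda>a b c. ?l t a * ?l u b * ?l v c"
  have left: "?l (insertion t (graft u v)) x = (\<Sum>a\<in>?A. \<Sum>b\<in>?B. \<Sum>c\<in>?C.
      ?k a b c * of_nat (\<Sum>y\<in>Y. subtree_number a y x * cut_number b c y))"
  proof -
    have "?l (insertion t (graft u v)) x =
        (\<Sum>a\<in>?A. \<Sum>y\<in>Y. ?l t a * ?l (graft u v) y * of_nat (subtree_number a y x))"
      by (rule lookup_insertion) (simp_all add: keys finY)
    also have "\<dots> = (\<Sum>a\<in>?A. \<Sum>y\<in>Y. \<Sum>b\<in>?B. \<Sum>c\<in>?C.
        ?k a b c * (of_nat (subtree_number a y x) * of_nat (cut_number b c y)))"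
      unfolding graft_y by (simp add: sum_distrib_left sum_distrib_right mult_ac)
    also have "\<dots> = (\<Sum>a\<in>?A. \<Sum>b\<in>?B. \<Sum>c\<in>?C. \<Sum>y\<in>Y.
        ?k a b c * (of_nat (subtree_number a y x) * of_nat (cut_number b c y)))"
      by (intro sum.cong refl sum_swap3)
    finally show ?thesis by (simp add: sum_distrib_left)
  qed
  have right1: "?l (graft (insertion t u) v) x = (\<Sum>a\<in>?A. \<Sum>b\<in>?B. \<Sum>c\<in>?C.
      ?k a b c * of_nat (\<Sum>y\<in>Y. cut_number y c x * subtree_number a b y))"
  proof -
    have "?l (graft (insertion t u) v) x =
        (\<Sum>y\<in>Y. \<Sum>c\<in>?C. ?l (insertion t u) y * ?l v c * of_nat (cut_number y c x))"
      by (rule lookup_graft) (simp_all add: keys finY)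
    also have "\<dots> = (\<Sum>y\<in>Y. \<Sum>c\<in>?C. \<Sum>a\<in>?A. \<Sum>b\<in>?B.
        ?k a b c * (of_nat (cut_number y c x) * of_nat (subtree_number a b y)))"
      unfolding ins_u by (simp add: sum_distrib_left sum_distrib_right mult_ac)
    also have "\<dots> = (\<Sum>y\<in>Y. \<Sum>a\<in>?A. \<Sum>b\<in>?B. \<Sum>c\<in>?C.
        ?k a b c * (of_nat (cut_number y c x) * of_nat (subtree_number a b y)))"
      by (intro sum.cong refl sum_swap3)
    also have "\<dots> = (\<Sum>a\<in>?A. \<Sum>b\<in>?B. \<Sum>y\<in>Y. \<Sum>c\<in>?C.
        ?k a b c * (of_nat (cut_number y c x) * of_nat (subtree_number a b y)))"
      by (rule sum_swap3)
    also have "\<dots> = (\<Sum>a\<in>?A. \<Sum>b\<in>?B. \<Sum>c\<in>?C. \<Sum>y\<in>Y.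
        ?k a b c * (of_nat (cut_number y c x) * of_nat (subtree_number a b y)))"
      by (intro sum.cong refl sum.swap)
    finally show ?thesis by (simp add: sum_distrib_left)
  qed
  have right2: "?l (graft u (insertion t v)) x = (\<Sum>a\<in>?A. \<Sum>b\<in>?B. \<Sum>c\<in>?C.
      ?k a b c * of_nat (\<Sum>y\<in>Y. cut_number b y x * subtree_number a c y))"
  proof -
    have "?l (graft u (insertion t v)) x =
        (\<Sum>b\<in>?B. \<Sum>y\<in>Y. ?l u b * ?l (insertion t v) y * of_nat (cut_number b y x))"
      by (rule lookup_graft) (simp_all add: keys finY)
    also have "\<dots> = (\<Sum>b\<in>?B. \<Sum>y\<in>Y. \<Sum>a\<in>?A. \<Sum>c\<in>?C.
        ?k a b c * (of_nat (cut_number b y x) * of_nat (subtree_number a c y)))"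
      unfolding ins_v by (simp add: sum_distrib_left sum_distrib_right mult_ac)
    also have "\<dots> = (\<Sum>b\<in>?B. \<Sum>a\<in>?A. \<Sum>c\<in>?C. \<Sum>y\<in>Y.
        ?k a b c * (of_nat (cut_number b y x) * of_nat (subtree_number a c y)))"
      by (intro sum.cong refl sum_swap3)
    also have "\<dots> = (\<Sum>a\<in>?A. \<Sum>b\<in>?B. \<Sum>c\<in>?C. \<Sum>y\<in>Y.
        ?k a b c * (of_nat (cut_number b y x) * of_nat (subtree_number a c y)))"
      by (rule sum.swap)
    finally show ?thesis by (simp add: sum_distrib_left)
  qed
  have coeff: "(\<Sum>y\<in>Y. subtree_number a y x * cut_number b c y) =
      (\<Sum>y\<in>Y. cut_number y c x * subtree_number a b y) +
      (\<Sum>y\<in>Y. cut_number b y x * subtree_number a c y)"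
    if "a \<in> ?A" "b \<in> ?B" "c \<in> ?C" for a b c
    by (rule structure_constants[OF finY]) (use that in \<open>auto simp: Y_def\<close>)
  show "?l (insertion t (graft u v)) x = ?l (graft (insertion t u) v + graft u (insertion t v)) x"
    unfolding lookup_add left right1 right2
    by (simp add: coeff distrib_left sum.distrib del: of_nat_sum)
qed

end
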